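(* Let $\alpha > 1/8$ be fixed. For every sufficiently large prime $p$ and every set $A \subseteq \mathbb{F}_p$ with $|A| \geqslant \alpha p$, one has $A(A+A) \supseteq \mathbb{F}_p^*$, where $A(A+A) = \{x(y+z) : x, y, z \in A\}$.
   Context: $\mathbb{F}_p$ is the field with $p$ elements ($p$ prime) and $\mathbb{F}_p^* = \mathbb{F}_p \setminus \{0\}$. *)

theory Defs
  imports Complex_Main "HOL-Number_Theory.Number_Theory"
begin

end

theory Submission
  imports Defs
begin

text \<open>
  If \<open>l \<noteq> 0\<close> is not in \<open>A(A + A)\<close>, then \<open>A + A\<close> misses \<open>B = l A\<^sup>-\<^sup>1\<close>. Smooth both indicators by an
  averaging kernel adapted to the large spectrum of \<open>B\<close>: the smoothed functions \<open>f, g\<close> still have almost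
  no solutions of \<open>y + z = b\<close>, so by Pollard's theorem their supports \<open>X, Y\<close> (up to a small
  threshold) satisfy \<open>2|X| + |Y| \<le> p + o(p)\<close>. On the other hand \<open>F = 1 - (1 - f)\<^sup>m\<close> and
  \<open>G = 1 - (1 - g)\<^sup>m\<close> are close to 1 on almost all of \<open>A\<close> and \<open>B\<close> and have absolutely convergent
  Fourier expansions of bounded norm, so a non-trivial bound for Kloosterman sums makes \<open>F(x)\<close> and
  \<open>G(l/x)\<close> independent. Hence \<open>|A| \<le> |X||Y|/p + o(p) \<le> p/8 + o(p)\<close>.
\<close>

text \<open>The constant 1/8 is the maximum of \<open>x * y\<close> under
  \<open>2 * x + y \<le> 1\<close>, attained at \<open>x = 1/4\<close>, \<open>y = 1/2\<close>. The
  obstacle is that the absolute sum of the Fourier coefficients of an indicator may grow like the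
  square root of \<open>p\<close>, which swamps the power of \<open>p\<close> saved by a Kloosterman
  bound. Smoothing brings this norm below a bound independent of \<open>p\<close>; after that any
  fixed power saving is enough, and the exponent 3/4 coming from a fourth moment will do. Smoothing
  has a price: on \<open>A\<close> the smoothed function is only known to be at least a small
  \<open>\<tau>\<close> outside few points, not to be near 1. The polynomial
  \<open>1 - (1 - u) ^ m\<close> repairs this: it lifts \<open>[\<tau>, 1]\<close> above
  \<open>1 - \<tau>\<close>, keeps \<open>[0, \<tau> / m]\<close> below \<open>\<tau>\<close>, and,
  being a polynomial, keeps the norm bounded. A second price is that forbidden solutions become rare
  rather than absent, so a mere lower bound for the size of a sumset would not do; Pollard's theorem
  counts representations with multiplicity. All parameters are fixed before \<open>p\<close>, in the
  order \<open>\<tau>\<close>, \<open>m\<close>, \<open>\<kappa>\<close>, \<open>N\<close>,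
  \<open>k\<close>, \<open>M\<close>.\<close>

text \<open>AM-GM in the form \<open>8 * u * v \<le> (2 * u + v)^2\<close> is the source of 1/8. The
  other two alternatives make one factor tiny, and \<open>\<tau> \<le> 1 / 20\<close> keeps the
  product below 1/8 there.\<close>

lemma level_product_le:
  fixes x y P \<tau> :: real
  assumes \<tau>: "0 < \<tau>" "\<tau> \<le> 1 / 20" and P: "0 < P" and nonneg: "0 \<le> x" "0 \<le> y"
    and cases: "x \<le> \<tau> * P \<and> y \<le> P \<or> y \<le> \<tau> * P \<and> x \<le> P \<or> 2 * x + y \<le> (1 + 2 * \<tau>) * P"
  shows "(x + \<tau> * P) * (y + \<tau> * P) \<le> (1 + 5 * \<tau>)\<^sup>2 / 8 * P\<^sup>2"
proof -
  have small: "(2 * \<tau> * P) * ((1 + \<tau>) * P) \<le> (1 + 5 * \<tau>)\<^sup>2 / 8 * P\<^sup>2"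
  proof -
    have "2 * \<tau> * (1 + \<tau>) \<le> 2 * (1 / 20) * (1 + 1 / 20)"
      using \<tau> by (intro mult_mono) auto
    also have "\<dots> \<le> 1 / 8" by simp
    also have "\<dots> \<le> (1 + 5 * \<tau>)\<^sup>2 / 8"
      using \<tau> by simp
    finally have "2 * \<tau> * (1 + \<tau>) * P\<^sup>2 \<le> (1 + 5 * \<tau>)\<^sup>2 / 8 * P\<^sup>2"
      by (rule mult_right_mono) simp
    then show ?thesis by (simp add: power2_eq_square mult_ac)
  qed
  from cases consider "x \<le> \<tau> * P" "y \<le> P" | "y \<le> \<tau> * P" "x \<le> P" | "2 * x + y \<le> (1 + 2 * \<tau>) * P"
    by blast
  then show ?thesis
  proof cases
    case 1
    have "(x + \<tau> * P) * (y + \<tau> * P) \<le> (2 * \<tau> * P) * ((1 + \<tau>) * P)"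
      using 1 nonneg \<tau> P by (intro mult_mono) (auto simp: algebra_simps)
    with small show ?thesis by linarith
  next
    case 2
    have "(x + \<tau> * P) * (y + \<tau> * P) \<le> ((1 + \<tau>) * P) * (2 * \<tau> * P)"
      using 2 nonneg \<tau> P by (intro mult_mono) (auto simp: algebra_simps)
    with small show ?thesis by (simp add: mult.commute)
  next
    case 3
    \<comment> \<open>Passing to \<open>u\<close> and \<open>v\<close> adds
      \<open>3 * \<tau> * P\<close> to \<open>2 * x + y\<close>, which turns
      \<open>1 + 2 * \<tau>\<close> into \<open>1 + 5 * \<tau>\<close>.\<close>
    define u v where "u = x + \<tau> * P" and "v = y + \<tau> * P"
    have uv: "0 \<le> 2 * u + v" "2 * u + v \<le> (1 + 5 * \<tau>) * P"
      using 3 nonneg \<tau> P by (auto simp: u_def v_def algebra_simps)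
    have "8 * (u * v) + (2 * u - v)\<^sup>2 = (2 * u + v)\<^sup>2"
      by (simp add: power2_eq_square algebra_simps)
    moreover have "0 \<le> (2 * u - v)\<^sup>2" by simp
    moreover have "(2 * u + v)\<^sup>2 \<le> ((1 + 5 * \<tau>) * P)\<^sup>2"
      using uv by (rule power_mono[rotated])
    ultimately have "8 * (u * v) \<le> (1 + 5 * \<tau>)\<^sup>2 * P\<^sup>2"
      unfolding power_mult_distrib by linarith
    then show ?thesis by (simp add: u_def v_def)
  qed
qed

text \<open>A chord is at most as long as its arc: the half-angle formula writes the chord as twice
  a sine.\<close>

lemma norm_cis_diff_le: "norm (cis s - cis t) \<le> \<bar>s - t\<bar>"
proof -
  have "(norm (cis s - cis t))\<^sup>2 = 2 - 2 * cos (s - t)"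
    by (simp add: cmod_power2 power2_diff cos_diff algebra_simps)
  also have "\<dots> = (2 * sin ((s - t) / 2))\<^sup>2"
    using cos_double_sin[of "(s - t) / 2"] unfolding times_divide_eq_right nonzero_mult_div_cancel_left[OF zero_neq_numeral[symmetric]]
    by (simp add: power_mult_distrib)
  also have "\<dots> \<le> (s - t)\<^sup>2"
    using abs_sin_x_le_abs_x[of "(s - t) / 2"] by (intro abs_le_square_iff[THEN iffD1]) simp
  finally show ?thesis
    by (metis abs_le_square_iff abs_norm_cancel)
qed

lemma sum_swap2:
  "(\<Sum>x\<in>X. \<Sum>y\<in>Y. \<Sum>a\<in>A. f x y a) = (\<Sum>a\<in>A. \<Sum>x\<in>X. \<Sum>y\<in>Y. f x y a)"
proof -
  have "(\<Sum>x\<in>X. \<Sum>y\<in>Y. \<Sum>a\<in>A. f x y a) = (\<Sum>x\<in>X. \<Sum>a\<in>A. \<Sum>y\<in>Y. f x y a)"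
    by (rule sum.cong[OF refl], rule sum.swap)
  also have "\<dots> = (\<Sum>a\<in>A. \<Sum>x\<in>X. \<Sum>y\<in>Y. f x y a)"
    by (rule sum.swap)
  finally show ?thesis .
qed

text \<open>Cauchy-Schwarz against the constant 1, read off from the expansion of a sum of squared
  differences.\<close>

lemma sum_squared_le:
  fixes f :: "'a \<Rightarrow> real"
  shows "(\<Sum>x\<in>X. f x)\<^sup>2 \<le> real (card X) * (\<Sum>x\<in>X. (f x)\<^sup>2)"
proof -
  have "0 \<le> (\<Sum>x\<in>X. \<Sum>y\<in>X. (f x - f y)\<^sup>2)"
    by (intro sum_nonneg) auto
  also have "\<dots> = (\<Sum>x\<in>X. \<Sum>y\<in>X. (f x)\<^sup>2) + (\<Sum>x\<in>X. \<Sum>y\<in>X. (f y)\<^sup>2) - 2 * (\<Sum>x\<in>X. \<Sum>y\<in>X. f x * f y)"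
    by (simp only: power2_diff sum.distrib sum_subtractf mult.assoc sum_distrib_left[of 2])
  also have "\<dots> = 2 * (real (card X) * (\<Sum>x\<in>X. (f x)\<^sup>2)) - 2 * (\<Sum>x\<in>X. f x)\<^sup>2"
  proof -
    have "(\<Sum>x\<in>X. \<Sum>y\<in>X. f x * f y) = (\<Sum>x\<in>X. f x)\<^sup>2"
      by (simp only: power2_eq_square sum_product)
    then show ?thesis by (simp add: sum_distrib_left)
  qed
  finally show ?thesis by simp
qed

section \<open>Residues modulo a prime, represented by integers\<close>

locale prime_modulus =
  fixes p :: nat
  assumes prime_p: "prime p"
begin

abbreviation Z :: "int set" where "Z \<equiv> {0..<int p}"

lemma p_pos [simp]: "0 < p" and p_ge_2: "2 \<le> p" and p_nonzero [simp]: "p \<noteq> 0"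
  using prime_p by (auto simp: prime_gt_0_nat prime_ge_2_nat)

lemma prime_int_p: "prime (int p)"
  using prime_p by simp

lemma mod_Z [simp]: "x mod int p \<in> Z"
  by simp

lemma coprime_p_iff: "coprime a (int p) \<longleftrightarrow> \<not> int p dvd a"
  using prime_int_p by (metis coprime_commute prime_imp_coprime coprime_absorb_left not_prime_unit)

lemma Z_not_dvd: "x \<in> Z \<Longrightarrow> x \<noteq> 0 \<Longrightarrow> \<not> int p dvd x"
  by (auto dest: zdvd_imp_le)

lemma Z_cong_eq: "x \<in> Z \<Longrightarrow> y \<in> Z \<Longrightarrow> int p dvd x - y \<Longrightarrow> x = y"
  by (metis atLeastLessThan_iff mod_eq_dvd_iff mod_pos_pos_trivial)

text \<open>Functions on the field are modelled as functions on all integers that are invariant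
  under reduction, so that shifts and dilations of the argument can be written without
  \<open>mod\<close>.\<close>

definition periodic :: "(int \<Rightarrow> 'a) \<Rightarrow> bool" where
  "periodic f \<longleftrightarrow> (\<forall>x. f (x mod int p) = f x)"

lemma periodicI: "(\<And>x. f (x mod int p) = f x) \<Longrightarrow> periodic f"
  by (simp add: periodic_def)

lemma inj_on_affine_mod:
  assumes "coprime a (int p)"
  shows "inj_on (\<lambda>x. (a * x + b) mod int p) Z"
proof (rule inj_onI)
  fix x y assume xy: "x \<in> Z" "y \<in> Z" "(a * x + b) mod int p = (a * y + b) mod int p"
  then have "int p dvd (a * x + b) - (a * y + b)"
    by (simp add: mod_eq_dvd_iff)
  then have "int p dvd a * (x - y)"
    by (simp add: algebra_simps)
  then have "int p dvd x - y"
    using assms coprime_dvd_mult_right_iff coprime_commute by blast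
  with xy show "x = y" using Z_cong_eq by blast
qed

lemma bij_betw_affine_mod:
  assumes "coprime a (int p)"
  shows "bij_betw (\<lambda>x. (a * x + b) mod int p) Z Z"
  unfolding bij_betw_def using inj_on_affine_mod[OF assms, of b]
  by (intro conjI endo_inj_surj) auto

lemma sum_affine:
  assumes "periodic f" "coprime a (int p)"
  shows "(\<Sum>x\<in>Z. f (a * x + b)) = sum f Z"
proof -
  have "sum f Z = (\<Sum>x\<in>Z. f ((a * x + b) mod int p))"
    using bij_betw_affine_mod[OF assms(2), of b] by (rule sum.reindex_bij_betw[symmetric])
  then show ?thesis using assms(1) by (simp add: periodic_def)
qed

lemma sum_shift: "periodic f \<Longrightarrow> (\<Sum>x\<in>Z. f (x + b)) = sum f Z"
  using sum_affine[of f 1 b] by simp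

lemma sum_shift_minus: "periodic f \<Longrightarrow> (\<Sum>x\<in>Z. f (x - b)) = sum f Z"
  using sum_shift[of f "- b"] by simp

subsection \<open>Additive characters\<close>

definition e :: "int \<Rightarrow> complex" where
  "e r = cis (2 * pi * real_of_int r / real p)"

lemma e_add: "e (r + s) = e r * e s"
  by (simp add: e_def cis_mult ring_distribs add_divide_distrib)

lemma e_0 [simp]: "e 0 = 1"
  by (simp add: e_def)

lemma norm_e [simp]: "norm (e r) = 1"
  by (simp add: e_def)

lemma cnj_e: "cnj (e r) = e (- r)"
  by (simp add: e_def cis_cnj)

lemma e_eq_1_iff: "e r = 1 \<longleftrightarrow> int p dvd r"
proof
  assume "e r = 1"
  then have "cos (2 * pi * real_of_int r / real p) = 1"
    by (simp add: e_def complex_eq_iff)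
  then obtain n :: int where "2 * pi * real_of_int r / real p = real_of_int n * 2 * pi"
    using cos_one_2pi_int by auto
  then have "real_of_int r = real_of_int (n * int p)"
    by (simp add: field_simps)
  then show "int p dvd r"
    by (metis dvd_triv_right of_int_eq_iff)
next
  assume "int p dvd r"
  then obtain k where "r = int p * k" ..
  then have "2 * pi * real_of_int r / real p = 2 * pi * real_of_int k"
    by simp
  then show "e r = 1"
    by (simp only: e_def cis_multiple_2pi Ints_of_int)
qed

lemma e_eq_iff: "e r = e s \<longleftrightarrow> int p dvd r - s"
proof -
  have "e r = e (r - s) * e s"
    using e_add[of "r - s" s] by simp
  moreover have "e s \<noteq> 0"
    by (metis norm_e norm_zero zero_neq_one)
  ultimately show ?thesis
    using e_eq_1_iff[of "r - s"] by auto
qed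

lemma periodic_e: "periodic (\<lambda>x. e (r * x + s))"
proof (rule periodicI)
  fix x
  have "int p dvd r * (x mod int p - x)"
    by (metis dvd_mult mod_eq_dvd_iff mod_mod_trivial)
  then show "e (r * (x mod int p) + s) = e (r * x + s)"
    by (simp add: e_eq_iff algebra_simps)
qed

lemma sum_e: "(\<Sum>x\<in>Z. e (r * x)) = (if int p dvd r then of_nat p else 0)"
proof (cases "int p dvd r")
  case True
  then have "e (r * x) = 1" for x
    by (simp add: e_eq_1_iff)
  with True show ?thesis by simp
next
  case False
  have "(\<Sum>x\<in>Z. e (r * x)) = (\<Sum>x\<in>Z. e (r * (x + 1)))"
    using sum_shift[OF periodic_e[of r 0], of 1] by simp
  also have "\<dots> = (\<Sum>x\<in>Z. e (r * x)) * e r"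
    by (simp add: ring_distribs e_add sum_distrib_right)
  finally have "(\<Sum>x\<in>Z. e (r * x)) * (e r - 1) = 0"
    by (simp add: algebra_simps)
  with False show ?thesis by (simp add: e_eq_1_iff)
qed

text \<open>The unnormalised Fourier transform of the indicator of \<open>A\<close>; Fourier
  inversion therefore uses \<open>S A (- r)\<close> and a division by \<open>p\<close>.\<close>

definition S :: "int set \<Rightarrow> int \<Rightarrow> complex" where
  "S A r = (\<Sum>x\<in>A. e (r * x))"

lemma S_minus: "S A (- r) = cnj (S A r)"
  by (simp add: S_def cnj_e)

lemma norm_S_minus: "norm (S A (- r)) = norm (S A r)"
  by (simp add: S_minus)

lemma norm_S_le: "norm (S A r) \<le> real (card A)"
  unfolding S_def by (rule order.trans[OF norm_sum]) simp

lemma card_le_p: "A \<subseteq> Z \<Longrightarrow> card A \<le> p"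
  using card_mono[of Z A] by simp

lemma finite_sub: "A \<subseteq> Z \<Longrightarrow> finite A"
  by (rule finite_subset) auto

lemma parseval:
  assumes "A \<subseteq> Z"
  shows "(\<Sum>r\<in>Z. (norm (S A r))\<^sup>2) = real p * real (card A)"
proof -
  have eq: "int p dvd x - y \<longleftrightarrow> x = y" if "x \<in> A" "y \<in> A" for x y
    using that assms Z_cong_eq[of x y] by (auto simp del: atLeastLessThan_iff)
  have "complex_of_real (\<Sum>r\<in>Z. (norm (S A r))\<^sup>2) = (\<Sum>r\<in>Z. S A r * S A (- r))"
    by (simp add: S_minus complex_norm_square del: of_real_power)
  also have "\<dots> = (\<Sum>r\<in>Z. \<Sum>x\<in>A. \<Sum>y\<in>A. e ((x - y) * r))"
    by (simp add: S_def sum_product e_add[symmetric] algebra_simps)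
  also have "\<dots> = (\<Sum>x\<in>A. \<Sum>y\<in>A. \<Sum>r\<in>Z. e ((x - y) * r))"
    by (subst sum.swap) (intro sum.cong refl sum.swap)
  also have "\<dots> = (\<Sum>x\<in>A. \<Sum>y\<in>A. if x = y then of_nat p else 0)"
    by (intro sum.cong refl) (simp add: sum_e eq)
  also have "\<dots> = complex_of_real (real p * real (card A))"
    using finite_sub[OF assms] by simp
  finally show ?thesis
    unfolding of_real_eq_iff .
qed

text \<open>The reduction is built in, which makes the indicator periodic on all integers.\<close>

definition ind :: "int set \<Rightarrow> int \<Rightarrow> real" where
  "ind A x = of_bool (x mod int p \<in> A)"

lemma ind_nonneg [simp]: "0 \<le> ind A x" and ind_le_1 [simp]: "ind A x \<le> 1"
  by (simp_all add: ind_def)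

lemma periodic_ind: "periodic (\<lambda>x. ind A (x + b))"
  by (rule periodicI) (simp add: ind_def mod_simps)

lemma ind_mod: "ind A (x mod int p + b) = ind A (x + b)"
    "ind A (a + x mod int p + b) = ind A (a + x + b)"
proof -
  show *: "ind A (x mod int p + b) = ind A (x + b)" for b
    by (simp add: ind_def mod_simps)
  show "ind A (a + x mod int p + b) = ind A (a + x + b)"
    using *[of "a + b"] by (simp add: add_ac)
qed

lemma ind_mono: "A \<subseteq> B \<Longrightarrow> ind A x \<le> ind B x"
  by (auto simp: ind_def)

lemma ind_on_Z: "x \<in> Z \<Longrightarrow> ind A x = of_bool (x \<in> A)"
  by (simp add: ind_def)

lemma sum_ind: 
  assumes "A \<subseteq> Z"
  shows "(\<Sum>x\<in>Z. ind A x * f x) = sum f A"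
proof -
  have "(\<Sum>x\<in>Z. ind A x * f x) = (\<Sum>x\<in>Z. if x \<in> A then f x else 0)"
    by (intro sum.cong refl) (simp add: ind_on_Z)
  also have "\<dots> = sum f (Z \<inter> A)"
    by (subst sum.inter_restrict) auto
  also have "Z \<inter> A = A" using assms by auto
  finally show ?thesis .
qed

text \<open>Fourier inversion: orthogonality in \<open>r\<close> isolates the element of
  \<open>A\<close> congruent to \<open>y\<close>.\<close>

lemma ind_expansion:
  assumes "A \<subseteq> Z"
  shows "complex_of_real (ind A y) = (\<Sum>r\<in>Z. S A (- r) * e (r * y)) / of_nat p"
proof -
  have "(\<Sum>r\<in>Z. S A (- r) * e (r * y)) = (\<Sum>r\<in>Z. \<Sum>x\<in>A. e ((y - x) * r))"
    unfolding S_def sum_distrib_right by (simp add: e_add[symmetric] algebra_simps)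
  also have "\<dots> = (\<Sum>x\<in>A. \<Sum>r\<in>Z. e ((y - x) * r))"
    by (rule sum.swap)
  also have "\<dots> = (\<Sum>x\<in>A. if y mod int p = x then of_nat p else 0)"
  proof (intro sum.cong refl)
    fix x assume "x \<in> A"
    with assms have "x mod int p = x" by auto
    then have "int p dvd y - x \<longleftrightarrow> y mod int p = x"
      by (metis mod_eq_dvd_iff)
    then show "(\<Sum>r\<in>Z. e ((y - x) * r)) = (if y mod int p = x then of_nat p else 0)"
      by (simp add: sum_e)
  qed
  also have "\<dots> = of_nat p * of_real (ind A y)"
    using finite_sub[OF assms] by (simp add: ind_def)
  finally show ?thesis by simp
qed

text \<open>Only the indicator of \<open>B\<close> is expanded; each of the two free variables in
  \<open>A\<close> then contributes one factor \<open>S A r\<close>.\<close>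

lemma sum_count_shift:
  assumes A: "A \<subseteq> Z" and B: "B \<subseteq> Z"
  shows "complex_of_real (\<Sum>y\<in>A. \<Sum>z\<in>A. ind B (y + z + h))
    = (\<Sum>r\<in>Z. S B (- r) * (S A r)\<^sup>2 * e (r * h)) / of_nat p"
proof -
  have "complex_of_real (\<Sum>y\<in>A. \<Sum>z\<in>A. ind B (y + z + h))
      = (\<Sum>y\<in>A. \<Sum>z\<in>A. \<Sum>r\<in>Z. S B (- r) * e (r * (y + z + h))) / of_nat p"
    by (simp add: ind_expansion[OF B] sum_divide_distrib)
  also have "(\<Sum>y\<in>A. \<Sum>z\<in>A. \<Sum>r\<in>Z. S B (- r) * e (r * (y + z + h)))
      = (\<Sum>y\<in>A. \<Sum>r\<in>Z. \<Sum>z\<in>A. S B (- r) * e (r * (y + z + h)))"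
    by (intro sum.cong refl sum.swap)
  also have "\<dots> = (\<Sum>r\<in>Z. \<Sum>y\<in>A. \<Sum>z\<in>A. S B (- r) * e (r * (y + z + h)))"
    by (rule sum.swap)
  also have "\<dots> = (\<Sum>r\<in>Z. S B (- r) * (S A r)\<^sup>2 * e (r * h))"
    unfolding S_def[of A] power2_eq_square sum_product sum_distrib_left sum_distrib_right
    by (simp add: e_add ring_distribs mult_ac)
  finally show ?thesis .
qed

text \<open>The count vanishes at shift 0, so the count at \<open>h\<close> equals its change from
  0, whose coefficients carry the factor \<open>e (r * h) - 1\<close>. That factor and
  \<open>S B\<close> are bounded uniformly, and Parseval absorbs the square of \<open>S A\<close>.
  Hence \<open>h\<close> has to be controlled only at frequencies where \<open>S B\<close> is large;
  the spectrum of \<open>A\<close> does not enter.\<close>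

lemma sum_count_shift_le:
  assumes A: "A \<subseteq> Z" and B: "B \<subseteq> Z"
    and disj: "\<And>y z. y \<in> A \<Longrightarrow> z \<in> A \<Longrightarrow> (y + z) mod int p \<notin> B"
    and h: "\<And>r. r \<in> Z \<Longrightarrow> norm (S B (- r)) * norm (e (r * h) - 1) \<le> \<kappa> * real p"
  shows "(\<Sum>y\<in>A. \<Sum>z\<in>A. ind B (y + z + h)) \<le> \<kappa> * (real p)\<^sup>2"
proof -
  let ?T = "\<lambda>h. \<Sum>y\<in>A. \<Sum>z\<in>A. ind B (y + z + h)"
  have \<kappa>: "0 \<le> \<kappa>"
  proof -
    have "0 \<le> \<kappa> * real p"
      using h[of 0] order.trans[OF mult_nonneg_nonneg[OF norm_ge_zero norm_ge_zero]] by simp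
    then show ?thesis by (simp add: zero_le_mult_iff)
  qed
  have T0: "?T 0 = 0"
    using disj by (simp add: ind_def)
  have "complex_of_real (?T h) = complex_of_real (?T h) - complex_of_real (?T 0)"
    unfolding T0 by simp
  also have "\<dots> = (\<Sum>r\<in>Z. S B (- r) * (S A r)\<^sup>2 * (e (r * h) - 1)) / of_nat p"
    unfolding sum_count_shift[OF A B] by (simp add: diff_divide_distrib right_diff_distrib sum_subtractf)
  finally have "norm (complex_of_real (?T h))
      = norm (\<Sum>r\<in>Z. S B (- r) * (S A r)\<^sup>2 * (e (r * h) - 1)) / real p"
    by (simp only: norm_divide norm_of_nat)
  also have "\<dots> \<le> (\<Sum>r\<in>Z. (norm (S A r))\<^sup>2 * (\<kappa> * real p)) / real p"
  proof (intro divide_right_mono order.trans[OF norm_sum] sum_mono)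
    fix r assume "r \<in> Z"
    then have "(norm (S A r))\<^sup>2 * (norm (S B (- r)) * norm (e (r * h) - 1))
        \<le> (norm (S A r))\<^sup>2 * (\<kappa> * real p)"
      by (intro mult_left_mono h) auto
    then show "norm (S B (- r) * (S A r)\<^sup>2 * (e (r * h) - 1)) \<le> (norm (S A r))\<^sup>2 * (\<kappa> * real p)"
      by (simp add: norm_mult norm_power mult_ac)
  qed auto
  also have "\<dots> = \<kappa> * (real p * real (card A))"
    unfolding sum_distrib_right[symmetric] parseval[OF A] by simp
  also have "\<dots> \<le> \<kappa> * (real p)\<^sup>2"
    unfolding power2_eq_square using card_le_p[OF A] \<kappa> by (intro mult_left_mono) auto
  finally show ?thesis
    unfolding norm_of_real by simp
qed

subsection \<open>Almost periods and smoothing\<close>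

text \<open>\<open>(int N * a) div int p\<close> is the index of the arc containing \<open>a\<close>
  when the residues are cut into \<open>N\<close> arcs of length \<open>p / N\<close>. Two residues
  in one arc have phases at most \<open>2 * pi / N\<close> apart.\<close>

lemma mod_fibre_close:
  fixes N :: nat
  assumes N: "0 < N"
    and fib: "(int N * (r * u mod int p)) div int p = (int N * (r * v mod int p)) div int p"
  shows "norm (e (r * (u - v)) - 1) \<le> 2 * pi / real N"
proof -
  define a b where "a = r * u mod int p" and "b = r * v mod int p"
  have ab: "\<bar>int N * a - int N * b\<bar> \<le> int p"
  proof -
    have "int N * a = int p * (int N * a div int p) + int N * a mod int p"
      "int N * b = int p * (int N * b div int p) + int N * b mod int p"
      by simp_all
    moreover have "int N * a div int p = int N * b div int p"
      using fib by (simp add: a_def b_def)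
    ultimately have "int N * a - int N * b = int N * a mod int p - int N * b mod int p"
      by (metis add_diff_cancel_left)
    moreover have "0 \<le> int N * a mod int p" "int N * a mod int p < int p"
      "0 \<le> int N * b mod int p" "int N * b mod int p < int p"
      by simp_all
    ultimately show ?thesis by linarith
  qed
  have "real_of_int \<bar>int N * a - int N * b\<bar> \<le> real_of_int (int p)"
    using ab by linarith
  then have ab': "real N * \<bar>real_of_int a - real_of_int b\<bar> \<le> real p"
    by (simp add: right_diff_distrib[symmetric] abs_mult)
  have "e (r * u) = e a" "e (r * v) = e b"
    unfolding a_def b_def by (simp_all add: e_eq_iff mod_eq_dvd_iff[symmetric])
  then have "norm (e (r * (u - v)) - 1) = norm (e a - e b)"
  proof -
    assume *: "e (r * u) = e a" "e (r * v) = e b"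
    have "e (r * u) - e (r * v) = (e (r * (u - v)) - 1) * e (r * v)"
      by (simp add: left_diff_distrib e_add[symmetric] right_diff_distrib)
    then show ?thesis
      by (metis * norm_e norm_mult mult.right_neutral)
  qed
  also have "\<dots> \<le> \<bar>2 * pi * real_of_int a / real p - 2 * pi * real_of_int b / real p\<bar>"
    unfolding e_def by (rule norm_cis_diff_le)
  also have "\<dots> = 2 * pi / real p * \<bar>real_of_int a - real_of_int b\<bar>"
    by (simp add: abs_mult diff_divide_distrib[symmetric] right_diff_distrib[symmetric])
  also have "\<dots> \<le> 2 * pi / real p * (real p / real N)"
    using ab' N by (intro mult_left_mono) (auto simp: field_simps)
  finally show ?thesis by simp
qed

text \<open>Pigeonhole: recording an arc for every frequency in \<open>R\<close> splits the residues
  into at most \<open>N ^ card R\<close> cells, and some cell has at least average size. A cell need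
  not lie near 0; only differences of its elements have small phases.\<close>

lemma large_fibre:
  fixes N :: nat
  assumes N: "0 < N" and R: "finite R"
  obtains Q where "Q \<subseteq> Z" "Q \<noteq> {}" "real p \<le> real (card Q) * real N ^ card R"
    "\<And>r u v. r \<in> R \<Longrightarrow> u \<in> Q \<Longrightarrow> v \<in> Q \<Longrightarrow> norm (e (r * (u - v)) - 1) \<le> 2 * pi / real N"
proof -
  define \<phi> where "\<phi> u = (\<lambda>r\<in>R. (int N * (r * u mod int p)) div int p)" for u
  define T where "T = (\<Pi>\<^sub>E r\<in>R. {0..<int N})"
  have T: "finite T" "card T = N ^ card R"
    using R by (auto simp: T_def finite_PiE card_PiE)
  have \<phi>: "\<phi> u \<in> T" for u
  proof -
    have "(int N * a) div int p \<in> {0..<int N}" if "a \<in> Z" for a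
    proof -
      have "int N * a < int N * int p"
        using that N by (intro mult_strict_left_mono) auto
      then have "int N * a div int p < int N"
      proof -
        assume less: "int N * a < int N * int p"
        have "int p * (int N * a div int p) \<le> int N * a"
          by (simp add: minus_mod_eq_mult_div[symmetric])
        with less have "int p * (int N * a div int p) < int p * int N"
          by (metis mult.commute order_le_less_trans)
        then show ?thesis by (rule mult_left_less_imp_less) simp
      qed
      then show ?thesis using that
        by (simp add: pos_imp_zdiv_nonneg_iff)
    qed
    then show ?thesis by (auto simp: \<phi>_def T_def)
  qed
  define fib where "fib t = {u \<in> Z. \<phi> u = t}" for t
  obtain t where t: "t \<in> T" "p \<le> card (fib t) * card T"
  proof -
    have "T \<noteq> {}" using \<phi> by auto
    have "p = card (\<Union>t\<in>T. fib t)"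
    proof -
      have "(\<Union>t\<in>T. fib t) = Z" using \<phi> by (auto simp: fib_def)
      then show ?thesis by simp
    qed
    also have "\<dots> \<le> (\<Sum>t\<in>T. card (fib t))"
      by (rule card_UN_le[OF T(1)])
    also have "\<dots> \<le> card T * Max ((\<lambda>t. card (fib t)) ` T)"
      using T(1) sum_bounded_above[of T "\<lambda>t. card (fib t)" "Max ((\<lambda>t. card (fib t)) ` T)"] by simp
    finally have "p \<le> card T * Max ((\<lambda>t. card (fib t)) ` T)" .
    moreover have "Max ((\<lambda>t. card (fib t)) ` T) \<in> (\<lambda>t. card (fib t)) ` T"
      using T(1) \<open>T \<noteq> {}\<close> by (intro Max_in) auto
    ultimately show thesis using that by (auto simp: mult.commute)
  qed
  show thesis
  proof (rule that[of "fib t"])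
    show "fib t \<subseteq> Z" by (auto simp: fib_def)
    show "fib t \<noteq> {}" using t(2) p_pos by (intro notI) simp
    have "real p \<le> real (card (fib t) * card T)" using t(2) by (rule of_nat_mono)
    then show "real p \<le> real (card (fib t)) * real N ^ card R" by (simp add: T)
    fix r u v assume "r \<in> R" "u \<in> fib t" "v \<in> fib t"
    then have "\<phi> u r = \<phi> v r" by (simp add: fib_def)
    then show "norm (e (r * (u - v)) - 1) \<le> 2 * pi / real N"
      using \<open>r \<in> R\<close> by (intro mod_fibre_close[OF N]) (simp add: \<phi>_def)
  qed
qed

lemma norm_e_add_minus_one_le: "norm (e (a + b) - 1) \<le> norm (e a - 1) + norm (e b - 1)"
proof -
  have "e (a + b) - 1 = e a * (e b - 1) + (e a - 1)"
    by (simp add: e_add algebra_simps)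
  then have "norm (e (a + b) - 1) \<le> norm (e a * (e b - 1)) + norm (e a - 1)"
    by (metis norm_triangle_ineq)
  then show ?thesis by (simp add: norm_mult)
qed

text \<open>Fibres of a partition according to the phases at the large spectrum of \<open>B\<close> play the
  role of Bohr sets: their size is bounded below in terms of \<open>\<kappa>\<close> alone.\<close>

lemma almost_periods:
  assumes \<kappa>: "0 < \<kappa>" "\<kappa> \<le> 1" and N: "0 < N" "6 * pi / real N \<le> \<kappa>" and k: "4 / \<kappa>\<^sup>2 \<le> real k"
    and A: "A \<subseteq> Z" and B: "B \<subseteq> Z"
    and disj: "\<And>y z. y \<in> A \<Longrightarrow> z \<in> A \<Longrightarrow> (y + z) mod int p \<notin> B"
  obtains Q where "Q \<subseteq> Z" "Q \<noteq> {}" "real p \<le> real (card Q) * real N ^ k"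
    "\<And>u1 v1 u2 v2 u3 v3. u1 \<in> Q \<Longrightarrow> v1 \<in> Q \<Longrightarrow> u2 \<in> Q \<Longrightarrow> v2 \<in> Q \<Longrightarrow> u3 \<in> Q \<Longrightarrow> v3 \<in> Q \<Longrightarrow>
      (\<Sum>y\<in>A. \<Sum>z\<in>A. ind B (y + z + ((u3 - v3) - (u1 - v1) - (u2 - v2)))) \<le> \<kappa> * (real p)\<^sup>2"
proof -
  \<comment> \<open>The large spectrum of \<open>B\<close>. The threshold has the factor 1/2 because
    outside \<open>R\<close> only the trivial bound 2 is available for the phase factor.\<close>
  define R where "R = {r \<in> Z. norm (S B (- r)) \<ge> \<kappa> / 2 * real p}"
  have R: "finite R" by (rule finite_subset[of _ Z]) (auto simp: R_def)
  \<comment> \<open>Parseval leaves room for at most \<open>4 / \<kappa>^2\<close> large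
    frequencies, whatever \<open>p\<close> is.\<close>
  have "(\<kappa> / 2 * real p)\<^sup>2 * real (card R) = (\<Sum>r\<in>R. (\<kappa> / 2 * real p)\<^sup>2)"
    by simp
  also have "\<dots> \<le> (\<Sum>r\<in>R. (norm (S B r))\<^sup>2)"
    using \<kappa> by (intro sum_mono power_mono) (auto simp: R_def norm_S_minus)
  also have "\<dots> \<le> (\<Sum>r\<in>Z. (norm (S B r))\<^sup>2)"
    by (rule sum_mono2) (auto simp: R_def)
  also have "\<dots> \<le> real p * real p"
    unfolding parseval[OF B] using card_le_p[OF B] by simp
  finally have "\<kappa>\<^sup>2 * real (card R) * (real p * real p) \<le> 4 * (real p * real p)"
    by (simp add: power2_eq_square algebra_simps)
  then have "\<kappa>\<^sup>2 * real (card R) \<le> 4"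
    using mult_le_cancel_right_pos[of "real p * real p"] by simp
  also have "4 \<le> \<kappa>\<^sup>2 * real k"
    using k \<kappa> by (simp add: pos_divide_le_eq mult.commute)
  finally have "\<kappa>\<^sup>2 * real (card R) \<le> \<kappa>\<^sup>2 * real k" .
  then have "real (card R) \<le> real k"
    by (rule mult_left_le_imp_le) (use \<kappa> in simp)
  then have Rk: "card R \<le> k" by simp
  obtain Q where Q: "Q \<subseteq> Z" "Q \<noteq> {}" "real p \<le> real (card Q) * real N ^ card R"
    "\<And>r u v. r \<in> R \<Longrightarrow> u \<in> Q \<Longrightarrow> v \<in> Q \<Longrightarrow> norm (e (r * (u - v)) - 1) \<le> 2 * pi / real N"
    by (rule large_fibre[OF N(1) R]) blast
  show thesis
  proof (rule that[of Q])
    show "Q \<subseteq> Z" "Q \<noteq> {}" by fact+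
    have "real (card Q) * real N ^ card R \<le> real (card Q) * real N ^ k"
      using N(1) Rk by (intro mult_left_mono power_increasing) auto
    with Q(3) show "real p \<le> real (card Q) * real N ^ k" by linarith
    fix u1 v1 u2 v2 u3 v3
    assume uv: "u1 \<in> Q" "v1 \<in> Q" "u2 \<in> Q" "v2 \<in> Q" "u3 \<in> Q" "v3 \<in> Q"
    let ?h = "(u3 - v3) - (u1 - v1) - (u2 - v2)"
    show "(\<Sum>y\<in>A. \<Sum>z\<in>A. ind B (y + z + ?h)) \<le> \<kappa> * (real p)\<^sup>2"
    proof (rule sum_count_shift_le[OF A B disj])
      fix r assume r: "r \<in> Z"
      show "norm (S B (- r)) * norm (e (r * ?h) - 1) \<le> \<kappa> * real p"
      proof (cases "r \<in> R")
        case True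
        \<comment> \<open>Each of the three differences costs \<open>2 * pi / N\<close>, whence the
          condition \<open>6 * pi / N \<le> \<kappa>\<close>.\<close>
        have h: "r * ?h = r * (u3 - v3) + (r * (v1 - u1) + r * (v2 - u2))"
          by (simp add: algebra_simps)
        have "norm (e (r * ?h) - 1) \<le> 2 * pi / real N + (2 * pi / real N + 2 * pi / real N)"
          unfolding h using uv True
          by (intro order.trans[OF norm_e_add_minus_one_le] add_mono Q(4))
        also have "\<dots> \<le> \<kappa>" using N by (simp add: field_simps)
        finally have "norm (e (r * ?h) - 1) \<le> \<kappa>" .
        moreover have "norm (S B (- r)) \<le> real p"
          using norm_S_le[of B "- r"] card_le_p[OF B] by linarith
        ultimately have "norm (S B (- r)) * norm (e (r * ?h) - 1) \<le> real p * \<kappa>"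
          by (intro mult_mono) auto
        then show ?thesis by (simp add: mult.commute)
      next
        case False
        then have "norm (S B (- r)) \<le> \<kappa> / 2 * real p" using r by (simp add: R_def)
        moreover have "norm (e (r * ?h) - 1) \<le> 2"
          using norm_triangle_ineq4[of "e (r * ?h)" 1] by simp
        ultimately have "norm (S B (- r)) * norm (e (r * ?h) - 1) \<le> (\<kappa> / 2 * real p) * 2"
          using \<kappa> by (intro mult_mono) auto
        then show ?thesis by simp
      qed
    qed
  qed
qed

text \<open>Convolution of the indicator with the law of \<open>u - v\<close> for \<open>u\<close>
  and \<open>v\<close> uniform in \<open>Q\<close>. Using differences of two points gives the
  multiplier \<open>|S Q r|^2 / |Q|^2\<close>, which is non-negative and can be summed by
  Parseval.\<close>

definition smooth :: "int set \<Rightarrow> int set \<Rightarrow> int \<Rightarrow> real" where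
  "smooth Q A x = (\<Sum>d\<in>Q \<times> Q. ind A (x + (fst d - snd d))) / (real (card Q))\<^sup>2"

lemma smooth_nonneg: "0 \<le> smooth Q A x"
  by (simp add: smooth_def sum_nonneg)

lemma smooth_le_1: "smooth Q A x \<le> 1"
proof -
  have "(\<Sum>d\<in>Q \<times> Q. ind A (x + (fst d - snd d))) \<le> (\<Sum>d\<in>Q \<times> Q. 1)"
    by (intro sum_mono) simp
  also have "\<dots> = (real (card Q))\<^sup>2"
    by (simp add: card_cartesian_product power2_eq_square)
  finally show ?thesis
    unfolding smooth_def by (intro divide_le_eq_1[THEN iffD2]) auto
qed

lemma smooth_mono: "A \<subseteq> B \<Longrightarrow> smooth Q A x \<le> smooth Q B x"
  unfolding smooth_def by (intro divide_right_mono sum_mono ind_mono) auto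

lemma periodic_smooth: "periodic (\<lambda>x. smooth Q A (x + b))"
  by (rule periodicI) (simp add: smooth_def ind_def mod_simps add.assoc)

text \<open>The weighted count is an average over three differences. Translating \<open>x\<close>
  and \<open>y\<close> moves the shifts of both copies of \<open>A\<close> onto \<open>B\<close>,
  which leaves the single shift of \<open>B\<close> appearing in the hypothesis.\<close>

lemma sum_count_smooth_le:
  assumes A: "A \<subseteq> Z" and Q: "Q \<subseteq> Z" "Q \<noteq> {}"
    and *: "\<And>u1 v1 u2 v2 u3 v3. u1 \<in> Q \<Longrightarrow> v1 \<in> Q \<Longrightarrow> u2 \<in> Q \<Longrightarrow> v2 \<in> Q \<Longrightarrow> u3 \<in> Q \<Longrightarrow> v3 \<in> Q \<Longrightarrow>
      (\<Sum>y\<in>A. \<Sum>z\<in>A. ind B (y + z + ((u3 - v3) - (u1 - v1) - (u2 - v2)))) \<le> C"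
  shows "(\<Sum>x\<in>Z. \<Sum>y\<in>Z. smooth Q A x * smooth Q A y * smooth Q B (x + y)) \<le> C"
proof -
  let ?D = "Q \<times> Q" and ?s = "\<lambda>d. fst d - snd d :: int"
  define q where "q = (real (card Q))\<^sup>2"
  have fQ: "finite Q" using finite_sub[OF Q(1)] .
  then have q: "0 < q" using Q by (simp add: card_gt_0_iff q_def)
  have cD: "real (card ?D) = q"
    by (simp add: card_cartesian_product power2_eq_square q_def)
  let ?I = "\<lambda>d1 d2 d3 x y. ind A (x + ?s d1) * ind A (y + ?s d2) * ind B (x + y + ?s d3)"
  have pt: "smooth Q A x * smooth Q A y * smooth Q B (x + y) =
      (\<Sum>d1\<in>?D. \<Sum>d2\<in>?D. \<Sum>d3\<in>?D. ?I d1 d2 d3 x y) / q ^ 3" for x y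
    unfolding smooth_def q_def[symmetric] times_divide_times_eq power3_eq_cube
    by (simp only: sum_distrib_left[symmetric] sum_distrib_right[symmetric])
  have inner: "(\<Sum>x\<in>Z. \<Sum>y\<in>Z. ?I d1 d2 d3 x y) \<le> C" if "d1 \<in> ?D" "d2 \<in> ?D" "d3 \<in> ?D" for d1 d2 d3
  proof -
    have "(\<Sum>x\<in>Z. \<Sum>y\<in>Z. ?I d1 d2 d3 x y)
        = (\<Sum>x\<in>Z. \<Sum>y\<in>Z. ind A (x + ?s d1) * ind A y * ind B (x + y + (?s d3 - ?s d2)))"
    proof (rule sum.cong[OF refl])
      fix x
      have "periodic (\<lambda>y. ind A (x + ?s d1) * ind A y * ind B (x + y + (?s d3 - ?s d2)))"
        by (rule periodicI) (simp only: ind_mod ind_mod(1)[where b = 0, simplified])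
      from sum_shift[OF this, of "?s d2"]
      show "(\<Sum>y\<in>Z. ?I d1 d2 d3 x y) = (\<Sum>y\<in>Z. ind A (x + ?s d1) * ind A y * ind B (x + y + (?s d3 - ?s d2)))"
        by (simp add: algebra_simps)
    qed
    also have "\<dots> = (\<Sum>x\<in>Z. \<Sum>y\<in>Z. ind A x * ind A y * ind B (x + y + (?s d3 - ?s d1 - ?s d2)))"
    proof -
      have "periodic (\<lambda>x. \<Sum>y\<in>Z. ind A x * ind A y * ind B (x + y + (?s d3 - ?s d1 - ?s d2)))"
        by (rule periodicI) (simp only: add.assoc ind_mod ind_mod(1)[where b = 0, simplified])
      from sum_shift[OF this, of "?s d1"] show ?thesis
        by (simp add: algebra_simps)
    qed
    also have "\<dots> = (\<Sum>x\<in>Z. ind A x * (\<Sum>y\<in>Z. ind A y * ind B (x + y + (?s d3 - ?s d1 - ?s d2))))"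
      by (simp add: sum_distrib_left mult_ac)
    also have "\<dots> = (\<Sum>x\<in>A. \<Sum>y\<in>A. ind B (x + y + (?s d3 - ?s d1 - ?s d2)))"
      by (simp only: sum_ind[OF A])
    also have "\<dots> \<le> C" using that by (intro *) auto
    finally show ?thesis .
  qed
  have "(\<Sum>x\<in>Z. \<Sum>y\<in>Z. smooth Q A x * smooth Q A y * smooth Q B (x + y))
      = (\<Sum>x\<in>Z. \<Sum>y\<in>Z. \<Sum>d1\<in>?D. \<Sum>d2\<in>?D. \<Sum>d3\<in>?D. ?I d1 d2 d3 x y) / q ^ 3"
    by (simp only: pt sum_divide_distrib)
  also have "(\<Sum>x\<in>Z. \<Sum>y\<in>Z. \<Sum>d1\<in>?D. \<Sum>d2\<in>?D. \<Sum>d3\<in>?D. ?I d1 d2 d3 x y)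
      = (\<Sum>d1\<in>?D. \<Sum>x\<in>Z. \<Sum>y\<in>Z. \<Sum>d2\<in>?D. \<Sum>d3\<in>?D. ?I d1 d2 d3 x y)"
    by (rule sum_swap2)
  also have "\<dots> = (\<Sum>d1\<in>?D. \<Sum>d2\<in>?D. \<Sum>x\<in>Z. \<Sum>y\<in>Z. \<Sum>d3\<in>?D. ?I d1 d2 d3 x y)"
    by (rule sum.cong[OF refl], rule sum_swap2)
  also have "\<dots> = (\<Sum>d1\<in>?D. \<Sum>d2\<in>?D. \<Sum>d3\<in>?D. \<Sum>x\<in>Z. \<Sum>y\<in>Z. ?I d1 d2 d3 x y)"
    by (rule sum.cong[OF refl], rule sum.cong[OF refl], rule sum_swap2)
  also have "\<dots> / q ^ 3 \<le> (\<Sum>d1\<in>?D. \<Sum>d2\<in>?D. \<Sum>d3\<in>?D. C) / q ^ 3"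
    using q by (intro divide_right_mono sum_mono inner) auto
  also have "(\<Sum>d1\<in>?D. \<Sum>d2\<in>?D. \<Sum>d3\<in>?D. C) = q ^ 3 * C"
    by (simp only: sum_constant cD power3_eq_cube mult.assoc)
  finally show ?thesis
    using q by simp
qed

text \<open>The averaging kernel has non-negative Fourier coefficients, so the correlation of \<open>D\<close>
  with its own average is at least the trivial one.\<close>

lemma card_sparse_le:
  assumes A: "A \<subseteq> Z" and Q: "Q \<subseteq> Z" "Q \<noteq> {}" and \<eta>: "0 \<le> \<eta>"
  shows "real (card {x \<in> A. smooth Q A x < \<eta>}) \<le> \<eta> * real p"
proof -
  define D where "D = {x \<in> A. smooth Q A x < \<eta>}"
  have D: "D \<subseteq> Z" "D \<subseteq> A" using A by (auto simp: D_def)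
  have fQ: "finite Q" using finite_sub[OF Q(1)] .
  have q: "0 < real (card Q)" using Q fQ by (simp add: card_gt_0_iff)
  let ?q = "real (card Q)"
  have row: "(\<Sum>x\<in>Z. ind D (x - u)) = real (card D)" for u
    using sum_shift_minus[OF periodic_ind[of D 0], of u] sum_ind[OF D(1), of "\<lambda>_. 1"] by simp
  \<comment> \<open>Cauchy-Schwarz for the number of ways to write \<open>x\<close> as an element of
    \<open>D\<close> plus one of \<open>Q\<close>. Its second moment, after a translation by
    \<open>u\<close>, is \<open>|Q|^2\<close> times the sum of \<open>smooth Q D\<close> over
    \<open>D\<close>.\<close>
  have "(real (card D) * ?q)\<^sup>2 = (\<Sum>x\<in>Z. \<Sum>u\<in>Q. ind D (x - u))\<^sup>2"
    by (subst sum.swap) (simp add: row mult.commute)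
  also have "\<dots> \<le> real p * (\<Sum>x\<in>Z. (\<Sum>u\<in>Q. ind D (x - u))\<^sup>2)"
    using sum_squared_le[of "\<lambda>x. \<Sum>u\<in>Q. ind D (x - u)" Z] by simp
  also have "(\<Sum>x\<in>Z. (\<Sum>u\<in>Q. ind D (x - u))\<^sup>2) = (\<Sum>u\<in>Q. \<Sum>v\<in>Q. \<Sum>x\<in>Z. ind D (x - u) * ind D (x - v))"
  proof -
    have "(\<Sum>x\<in>Z. (\<Sum>u\<in>Q. ind D (x - u))\<^sup>2) = (\<Sum>x\<in>Z. \<Sum>u\<in>Q. \<Sum>v\<in>Q. ind D (x - u) * ind D (x - v))"
      by (simp only: power2_eq_square sum_product)
    also have "\<dots> = (\<Sum>u\<in>Q. \<Sum>x\<in>Z. \<Sum>v\<in>Q. ind D (x - u) * ind D (x - v))"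
      by (rule sum.swap)
    also have "\<dots> = (\<Sum>u\<in>Q. \<Sum>v\<in>Q. \<Sum>x\<in>Z. ind D (x - u) * ind D (x - v))"
      by (intro sum.cong refl sum.swap)
    finally show ?thesis .
  qed
  also have "\<dots> = (\<Sum>u\<in>Q. \<Sum>v\<in>Q. \<Sum>x\<in>Z. ind D x * ind D (x + (u - v)))"
  proof (rule sum.cong[OF refl], rule sum.cong[OF refl])
    fix u v
    have "periodic (\<lambda>x. ind D x * ind D (x + (u - v)))"
      by (rule periodicI) (simp only: ind_mod ind_mod(1)[where b = 0, simplified])
    from sum_shift_minus[OF this, of u]
    show "(\<Sum>x\<in>Z. ind D (x - u) * ind D (x - v)) = (\<Sum>x\<in>Z. ind D x * ind D (x + (u - v)))"
      by (simp add: algebra_simps)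
  qed
  also have "\<dots> = (\<Sum>u\<in>Q. \<Sum>v\<in>Q. \<Sum>x\<in>D. ind D (x + (u - v)))"
    by (simp only: sum_ind[OF D(1)])
  also have "\<dots> = (\<Sum>d\<in>Q \<times> Q. \<Sum>x\<in>D. ind D (x + (fst d - snd d)))"
    unfolding sum.cartesian_product[of _ Q Q] case_prod_unfold ..
  also have "\<dots> = (\<Sum>x\<in>D. smooth Q D x) * ?q\<^sup>2"
    using q by (subst sum.swap) (simp add: smooth_def sum_divide_distrib[symmetric])
  \<comment> \<open>On \<open>D\<close> the average of the smaller set \<open>D\<close> is dominated
    by that of \<open>A\<close>, which is below \<open>\<eta>\<close> there.\<close>
  also have "\<dots> \<le> (\<Sum>x\<in>D. \<eta>) * ?q\<^sup>2"
  proof (intro mult_right_mono sum_mono)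
    fix x assume "x \<in> D"
    then show "smooth Q D x \<le> \<eta>"
      using smooth_mono[OF D(2), of Q x] by (simp add: D_def)
  qed auto
  finally have "(real (card D) * ?q)\<^sup>2 \<le> real p * (real (card D) * \<eta> * ?q\<^sup>2)"
    by (simp add: mult_left_mono)
  then have "real (card D) * (real (card D) * ?q\<^sup>2) \<le> (\<eta> * real p) * (real (card D) * ?q\<^sup>2)"
    by (simp add: power2_eq_square mult_ac)
  then have "card D = 0 \<or> real (card D) \<le> \<eta> * real p"
    using q by (cases "card D = 0") (auto dest!: mult_right_le_imp_le)
  then show ?thesis using \<eta> by (auto simp: D_def)
qed

subsection \<open>Pollard's theorem\<close>

definition rep :: "int set \<Rightarrow> int set \<Rightarrow> int \<Rightarrow> nat" where
  "rep A B c = card {b \<in> B. (c - b) mod int p \<in> A}"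

lemma rep_le_card: "finite B \<Longrightarrow> rep A B c \<le> card B"
  unfolding rep_def by (rule card_mono) auto

lemma rep_conv_sum: "finite B \<Longrightarrow> real (rep A B c) = (\<Sum>b\<in>B. ind A (c - b))"
  by (simp add: rep_def ind_def sum.If_cases Int_def of_bool_def)

lemma periodic_rep: "periodic (rep A B)"
  by (rule periodicI) (simp add: rep_def mod_simps)

lemma sum_rep:
  assumes "A \<subseteq> Z" "B \<subseteq> Z"
  shows "(\<Sum>c\<in>Z. rep A B c) = card A * card B"
proof -
  have "real (\<Sum>c\<in>Z. rep A B c) = (\<Sum>c\<in>Z. \<Sum>b\<in>B. ind A (c - b))"
    using finite_sub[OF assms(2)] by (simp add: rep_conv_sum)
  also have "\<dots> = (\<Sum>b\<in>B. \<Sum>c\<in>Z. ind A (c - b))"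
    by (rule sum.swap)
  also have "\<dots> = (\<Sum>b\<in>B. real (card A))"
    using sum_shift_minus[OF periodic_ind[of A 0]] sum_ind[OF assms(1), of "\<lambda>_. 1"] by simp
  also have "\<dots> = real (card A * card B)" by simp
  finally show ?thesis by (simp only: of_nat_eq_iff)
qed

lemma inj_on_sub_mod: "B \<subseteq> Z \<Longrightarrow> inj_on (\<lambda>b. (c - b) mod int p) B"
  using inj_on_affine_mod[of "- 1" c] by (auto intro: inj_on_subset simp: algebra_simps)

text \<open>Inclusion-exclusion for \<open>A\<close> and the reflected set \<open>c - B\<close>,
  which both lie among \<open>p\<close> residues and intersect in \<open>rep A B c\<close>
  points.\<close>

lemma rep_ge:
  assumes "A \<subseteq> Z" "B \<subseteq> Z"
  shows "card A + card B \<le> p + rep A B c"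
proof -
  let ?f = "\<lambda>b. (c - b) mod int p"
  have fin: "finite A" "finite B" using assms finite_sub by auto
  have "card A + card B = card A + card (?f ` B)"
    by (simp add: card_image[OF inj_on_sub_mod[OF assms(2)]])
  also have "\<dots> = card (A \<union> ?f ` B) + card (A \<inter> ?f ` B)"
    using fin by (intro card_Un_Int) auto
  also have "\<dots> \<le> p + rep A B c"
  proof (rule add_mono)
    show "card (A \<union> ?f ` B) \<le> p" using assms(1) by (intro card_le_p) auto
    have "A \<inter> ?f ` B = ?f ` {b \<in> B. ?f b \<in> A}" by auto
    then show "card (A \<inter> ?f ` B) \<le> rep A B c"
      unfolding rep_def using fin by (simp add: card_image_le)
  qed
  finally show ?thesis .
qed

definition translate :: "int \<Rightarrow> int set \<Rightarrow> int set" where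
  "translate u A = {x \<in> Z. (x - u) mod int p \<in> A}"

lemma translate_conv: "A \<subseteq> Z \<Longrightarrow> translate u A = (\<lambda>x. (x + u) mod int p) ` A"
proof safe
  fix x assume A: "A \<subseteq> Z" and x: "x \<in> translate u A"
  then have "x = ((x - u) mod int p + u) mod int p" "(x - u) mod int p \<in> A"
    by (auto simp: translate_def mod_simps)
  then show "x \<in> (\<lambda>x. (x + u) mod int p) ` A" by blast
next
  fix x assume A: "A \<subseteq> Z" and x: "x \<in> A"
  then have "x mod int p = x" by auto
  with x show "(x + u) mod int p \<in> translate u A"
    by (auto simp: translate_def mod_simps)
qed

lemma translate_sub: "translate u A \<subseteq> Z"
  by (auto simp: translate_def)

lemma card_translate: "A \<subseteq> Z \<Longrightarrow> card (translate u A) = card A"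
  using inj_on_affine_mod[of 1 u] by (simp add: translate_conv card_image inj_on_subset)

lemma rep_translate: "rep (translate u A) B c = rep A B (c - u)"
  by (simp add: rep_def translate_def mod_simps algebra_simps)

text \<open>Dyson's transform loses no representation. The only pairs \<open>(a, b)\<close> not
  accounted for literally have \<open>a\<close> in \<open>A \<inter> B\<close> and \<open>b\<close>
  in \<open>B - A\<close>; swapping the summands makes them pairs for
  \<open>(A \<union> B, A \<inter> B)\<close>.\<close>

lemma rep_decompose:
  assumes "A \<subseteq> Z" "B \<subseteq> Z"
  shows "rep A B c = rep (A - B) (B - A) c + rep (A \<union> B) (A \<inter> B) c"
proof -
  have fin: "finite A" "finite B" using assms finite_sub by auto
  let ?f = "\<lambda>b. (c - b) mod int p"
  have inv: "?f (?f b) = b" if "b \<in> B" for b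
    using that assms by (auto simp: mod_simps)
  have inv': "?f (?f b) = b" if "b \<in> A" for b
    using that assms by (auto simp: mod_simps)
  have eq: "{b \<in> B. ?f b \<in> A} = {b \<in> B - A. ?f b \<in> A - B} \<union>
      ({b \<in> B - A. ?f b \<in> A \<inter> B} \<union> {b \<in> A \<inter> B. ?f b \<in> A})"
    by blast
  have eq2: "{b \<in> A \<inter> B. ?f b \<in> A \<union> B} = {b \<in> A \<inter> B. ?f b \<in> B - A} \<union> {b \<in> A \<inter> B. ?f b \<in> A}"
    by blast
  have "bij_betw ?f {b \<in> B - A. ?f b \<in> A \<inter> B} {b \<in> A \<inter> B. ?f b \<in> B - A}"
    by (rule bij_betw_byWitness[where f' = ?f]) (use inv inv' in auto)
  then have card_eq: "card {b \<in> B - A. ?f b \<in> A \<inter> B} = card {b \<in> A \<inter> B. ?f b \<in> B - A}"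
    by (rule bij_betw_same_card)
  have "rep A B c = card {b \<in> B - A. ?f b \<in> A - B} +
      (card {b \<in> B - A. ?f b \<in> A \<inter> B} + card {b \<in> A \<inter> B. ?f b \<in> A})"
    unfolding rep_def eq using fin by (subst card_Un_disjoint; (subst card_Un_disjoint)?) auto
  moreover have "rep (A \<union> B) (A \<inter> B) c = card {b \<in> A \<inter> B. ?f b \<in> B - A} + card {b \<in> A \<inter> B. ?f b \<in> A}"
    unfolding rep_def eq2 using fin by (intro card_Un_disjoint) auto
  ultimately show ?thesis using card_eq by (simp add: rep_def)
qed

text \<open>Otherwise every translate of \<open>A\<close> that meets \<open>B\<close> contains
  \<open>B\<close>, so \<open>A\<close> is closed under adding the difference of two elements of
  \<open>B\<close>. Modulo a prime this difference generates everything and \<open>A\<close> would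
  be all of \<open>Z\<close>. The overlap found here is what makes the induction in Pollard's
  theorem descend.\<close>

lemma exists_proper_overlap:
  assumes A: "A \<subseteq> Z" "A \<noteq> {}" "A \<noteq> Z" and B: "B \<subseteq> Z" "2 \<le> card B"
  obtains u where "translate u A \<inter> B \<noteq> {}" "\<not> B \<subseteq> translate u A"
proof (rule ccontr)
  assume nothesis: "\<not> thesis"
  have *: "translate u A \<inter> B \<noteq> {} \<Longrightarrow> B \<subseteq> translate u A" for u
    using that nothesis by blast
  have "\<exists>b1 b2. b1 \<in> B \<and> b2 \<in> B \<and> b1 \<noteq> b2"
  proof (rule ccontr)
    assume "\<not> ?thesis"
    then have "B \<subseteq> {SOME b. b \<in> B}" by (metis someI_ex insertI1 subsetI)
    then have "card B \<le> 1" using card_mono[of "{SOME b. b \<in> B}" B] by simp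
    with B show False by simp
  qed
  then obtain b1 b2 where b: "b1 \<in> B" "b2 \<in> B" "b1 \<noteq> b2" by blast
  define d where "d = b2 - b1"
  have d: "coprime d (int p)"
    using b B Z_cong_eq[of b2 b1] unfolding coprime_p_iff d_def by blast
  have step: "(a + d) mod int p \<in> A" if "a \<in> A" for a
  proof -
    have "b1 \<in> translate (b1 - a) A" using that b A B by (auto simp: translate_def)
    with b have "b2 \<in> translate (b1 - a) A" using * by blast
    then show ?thesis by (simp add: translate_def d_def algebra_simps)
  qed
  obtain a where a: "a \<in> A" using A by blast
  have iter: "(d * int k + a) mod int p \<in> A" for k
  proof (induction k)
    case 0
    then show ?case using a A by auto
  next
    case (Suc k)
    from step[OF this] show ?case by (simp add: mod_simps algebra_simps)
  qed
  have "Z = (\<lambda>x. (d * x + a) mod int p) ` Z"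
    using bij_betw_affine_mod[OF d, of a] by (simp add: bij_betw_def)
  also have "\<dots> \<subseteq> A"
  proof safe
    fix x assume "x \<in> Z"
    then show "(d * x + a) mod int p \<in> A" using iter[of "nat x"] by simp
  qed
  finally show False using A by blast
qed

text \<open>Dyson's transform: after a translation the pair \<open>(A, B)\<close> is
  replaced by \<open>(A \<union> B, A \<inter> B)\<close>, or split off by \<open>(A - B, B - A)\<close> when \<open>A \<inter> B\<close> is too small.\<close>

theorem pollard:
  assumes "A \<subseteq> Z" "B \<subseteq> Z" "t \<le> card A" "t \<le> card B"
  shows "t * min p (card A + card B - t) \<le> (\<Sum>c\<in>Z. min t (rep A B c))"
  using assms
proof (induction "card B" arbitrary: A B t rule: less_induct)
  case less
  note A = less.prems(1) and B = less.prems(2)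
  have fin: "finite A" "finite B" using A B finite_sub by auto
  \<comment> \<open>The first three cases need no transform: nothing to count, every residue having
    at least \<open>t\<close> representations, and a truncation at \<open>t\<close> that never takes
    effect.\<close>
  consider "t = 0" | "p + t \<le> card A + card B" | "t = card B"
    | "0 < t" "card A + card B < p + t" "t < card B"
    using less.prems by linarith
  then show ?case
  proof cases
    case 1
    then show ?thesis by simp
  next
    case 2
    then have "t \<le> rep A B c" for c using rep_ge[OF A B, of c] by linarith
    then have "min t (rep A B c) = t" for c by (simp add: min_absorb1)
    then have "(\<Sum>c\<in>Z. min t (rep A B c)) = t * p" by (simp add: mult.commute)
    then show ?thesis by simp
  next
    case 3
    then have "min t (rep A B c) = rep A B c" for c using rep_le_card[OF fin(2)] by (simp add: min_absorb2)
    then have "(\<Sum>c\<in>Z. min t (rep A B c)) = card A * t" using sum_rep[OF A B] 3 by simp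
    then show ?thesis using 3 by simp
  next
    case 4
    have "card A < p" using 4 by linarith
    then have "A \<noteq> Z" by auto
    moreover have "A \<noteq> {}" using less.prems 4 by auto
    moreover have "2 \<le> card B" using 4 by linarith
    ultimately obtain u where u: "translate u A \<inter> B \<noteq> {}" "\<not> B \<subseteq> translate u A"
      using exists_proper_overlap[OF A _ _ B] by blast
    define A' where "A' = translate u A"
    have A': "A' \<subseteq> Z" "card A' = card A" "finite A'"
      using translate_sub card_translate[OF A] finite_sub[OF translate_sub] by (auto simp: A'_def)
    have "periodic (\<lambda>c. min t (rep A B c))"
      using periodic_rep[of A B] by (simp add: periodic_def)
    from sum_shift_minus[OF this, of u]
    have goal_eq: "(\<Sum>c\<in>Z. min t (rep A B c)) = (\<Sum>c\<in>Z. min t (rep A' B c))"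
      by (simp add: A'_def rep_translate)
    let ?I = "A' \<inter> B" and ?U = "A' \<union> B"
    have I: "0 < card ?I" using u fin by (auto simp: A'_def card_gt_0_iff)
    have IB: "card ?I < card B" using u fin(2) by (intro psubset_card_mono) (auto simp: A'_def)
    have UI: "card ?U + card ?I = card A + card B" using card_Un_Int[of A' B] A' fin by simp
    have IA: "card ?I \<le> card A'" using A' by (intro card_mono) auto
    show ?thesis
    \<comment> \<open>If the intersection still has \<open>t\<close> elements, the transformed pair
      has the same total size and a smaller second set. Otherwise all \<open>i < t\<close> possible
      representations by union and intersection are kept, and induction with \<open>t - i\<close> is
      applied to the two differences.\<close>
    proof (cases "t \<le> card ?I")
      case True
      have "t * min p (card ?U + card ?I - t) \<le> (\<Sum>c\<in>Z. min t (rep ?U ?I c))"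
      proof (rule less.hyps[OF IB])
        show "t \<le> card ?U" using UI IA A' less.prems IB by linarith
      qed (use True A' B in auto)
      also have "\<dots> \<le> (\<Sum>c\<in>Z. min t (rep A' B c))"
        by (intro sum_mono min.mono order.refl) (simp add: rep_decompose[OF A'(1) B])
      finally show ?thesis by (simp add: UI goal_eq)
    next
      case False
      define i where "i = card ?I"
      have cA: "card (A' - B) = card A - i" and cB: "card (B - A') = card B - i"
        using A' fin by (simp_all add: card_Diff_subset_Int i_def Int_commute)
      have le: "i \<le> card A" "i < t" "i < card B" "0 < i"
        using IA A' False IB I by (simp_all add: i_def)
      have "(t - i) * min p (card (A' - B) + card (B - A') - (t - i))
          \<le> (\<Sum>c\<in>Z. min (t - i) (rep (A' - B) (B - A') c))"
      proof (rule less.hyps)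
        show "card (B - A') < card B" using le by (simp add: cB)
      qed (use A' B less.prems 4 in \<open>auto simp: cA cB\<close>)
      moreover have "card (A' - B) + card (B - A') - (t - i) = card A + card B - i - t"
        using le less.prems by (simp add: cA cB)
      moreover have "min p (card A + card B - i - t) = card A + card B - i - t"
        using 4 by simp
      ultimately have 1: "(t - i) * (card A + card B - i - t)
          \<le> (\<Sum>c\<in>Z. min (t - i) (rep (A' - B) (B - A') c))"
        by simp
      have 2: "(\<Sum>c\<in>Z. rep ?U ?I c) = (card A + card B - i) * i"
      proof -
        have "card ?U = card A + card B - i" using UI by (simp add: i_def)
        moreover have "?U \<subseteq> Z" "?I \<subseteq> Z" using A' B by auto
        ultimately show ?thesis using sum_rep[of ?U ?I] by (simp add: i_def)
      qed
      \<comment> \<open>A representation count for \<open>?U\<close> and \<open>?I\<close> never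
        exceeds \<open>i\<close>, so adding it to a count truncated at \<open>t - i\<close> stays
        within \<open>t\<close>.\<close>
      have "min (t - i) (rep (A' - B) (B - A') c) + rep ?U ?I c \<le> min t (rep A' B c)" for c
        using rep_le_card[of ?I ?U c] fin le by (simp add: rep_decompose[OF A'(1) B] i_def)
      then have "(\<Sum>c\<in>Z. min (t - i) (rep (A' - B) (B - A') c)) + (\<Sum>c\<in>Z. rep ?U ?I c)
          \<le> (\<Sum>c\<in>Z. min t (rep A' B c))"
        unfolding sum.distrib[symmetric] by (intro sum_mono)
      with 1 2 have 3: "(t - i) * (card A + card B - i - t) + (card A + card B - i) * i
          \<le> (\<Sum>c\<in>Z. min t (rep A' B c))"
        by linarith
      \<comment> \<open>Subtraction on naturals truncates; naming the differences by
        \<open>s\<close> and \<open>j\<close> reduces the identity to a polynomial one.\<close>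
      define s where "s = card A + card B - i - t"
      have s: "card A + card B - i = s + t" using le less.prems by (simp add: s_def)
      obtain j where j: "t = i + j" using le less_imp_add_positive by blast
      have "(t - i) * s + (s + t) * i = t * (card A + card B - t)"
      proof -
        have "card A + card B - t = s + i" using s le less.prems by linarith
        then show ?thesis by (simp add: j algebra_simps)
      qed
      with 3 have "t * (card A + card B - t) \<le> (\<Sum>c\<in>Z. min t (rep A' B c))"
        by (simp add: s s_def[symmetric])
      then show ?thesis using 4 by (simp add: goal_eq)
    qed
  qed
qed

subsection \<open>Kloosterman sums\<close>

abbreviation U :: "int set" where "U \<equiv> {1..<int p}"

definition recip :: "int \<Rightarrow> int" where
  "recip x = modular_inverse (int p) x"

lemma U_sub_Z: "U \<subseteq> Z"
  by auto

lemma U_not_dvd: "x \<in> U \<Longrightarrow> \<not> int p dvd x"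
  using Z_not_dvd[of x] by auto

lemma mod_in_U: "\<not> int p dvd x \<Longrightarrow> x mod int p \<in> U"
  by (smt (verit) atLeastLessThan_iff dvd_eq_mod_eq_0 mod_Z)

lemma dvd_recip: "x \<in> U \<Longrightarrow> int p dvd x * recip x - 1"
  using cong_modular_inverse1[of x "int p"] U_not_dvd[of x] coprime_p_iff[of x]
  by (simp add: recip_def cong_iff_dvd_diff coprime_commute)

lemma recip_U: 
  assumes "x \<in> U" shows "recip x \<in> U"
proof -
  have "recip x \<in> Z"
    using modular_inverse_int_nonneg[of "int p" x] modular_inverse_int_less[of "int p" x]
    by (simp add: recip_def)
  moreover have "recip x \<noteq> 0"
  proof
    assume "recip x = 0"
    with dvd_recip[OF assms] have "int p dvd 1" by simp
    then show False using p_ge_2 by simp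
  qed
  ultimately show ?thesis by auto
qed

lemma dvd_mult_cancel: "\<not> int p dvd a \<Longrightarrow> int p dvd a * b \<longleftrightarrow> int p dvd b"
  using prime_int_p prime_dvd_mult_iff by blast

lemma inj_on_recip: "inj_on recip U"
proof (rule inj_onI)
  fix x y assume xy: "x \<in> U" "y \<in> U" "recip x = recip y"
  have "int p dvd (x * recip x - 1) - (y * recip y - 1)"
    using dvd_recip[OF xy(1)] dvd_recip[OF xy(2)] by (rule dvd_diff)
  then have "int p dvd recip x * (x - y)"
    using xy by (simp add: algebra_simps)
  then have "int p dvd x - y"
    using dvd_mult_cancel[OF U_not_dvd[OF recip_U[OF xy(1)]]] by simp
  then show "x = y" using xy U_sub_Z Z_cong_eq by blast
qed

definition kloosterman :: "int \<Rightarrow> int \<Rightarrow> complex" where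
  "kloosterman a b = (\<Sum>x\<in>U. e (a * x + b * recip x))"

text \<open>Open the square; orthogonality in \<open>a\<close> and in \<open>b\<close> enforces the
  two congruences independently. Applied to pairs, where a squared Kloosterman sum is itself such a
  sum, this yields a fourth moment.\<close>

lemma sum_square_e2:
  assumes "finite W"
  shows "(\<Sum>a\<in>Z. \<Sum>b\<in>Z. (norm (\<Sum>w\<in>W. e (a * s w + b * t w)))\<^sup>2)
    = (real p)\<^sup>2 * (\<Sum>w\<in>W. real (card {v \<in> W. int p dvd s w - s v \<and> int p dvd t w - t v}))"
proof -
  have "complex_of_real (\<Sum>a\<in>Z. \<Sum>b\<in>Z. (norm (\<Sum>w\<in>W. e (a * s w + b * t w)))\<^sup>2)
      = (\<Sum>a\<in>Z. \<Sum>b\<in>Z. (\<Sum>w\<in>W. e (a * s w + b * t w)) * (\<Sum>v\<in>W. e (- (a * s v + b * t v))))"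
    by (simp add: complex_norm_square cnj_e del: of_real_power)
  also have "\<dots> = (\<Sum>a\<in>Z. \<Sum>b\<in>Z. \<Sum>w\<in>W. \<Sum>v\<in>W. e ((s w - s v) * a) * e ((t w - t v) * b))"
    by (simp add: sum_product e_add[symmetric] algebra_simps)
  also have "\<dots> = (\<Sum>w\<in>W. \<Sum>a\<in>Z. \<Sum>b\<in>Z. \<Sum>v\<in>W. e ((s w - s v) * a) * e ((t w - t v) * b))"
    by (rule sum_swap2)
  also have "\<dots> = (\<Sum>w\<in>W. \<Sum>v\<in>W. \<Sum>a\<in>Z. \<Sum>b\<in>Z. e ((s w - s v) * a) * e ((t w - t v) * b))"
    by (rule sum.cong[OF refl], rule sum_swap2)
  also have "\<dots> = (\<Sum>w\<in>W. \<Sum>v\<in>W. (\<Sum>a\<in>Z. e ((s w - s v) * a)) * (\<Sum>b\<in>Z. e ((t w - t v) * b)))"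
    by (simp only: sum_product)
  also have "\<dots> = (\<Sum>w\<in>W. \<Sum>v\<in>W. if int p dvd s w - s v \<and> int p dvd t w - t v then (of_nat p)\<^sup>2 else 0)"
    by (intro sum.cong refl) (simp add: sum_e power2_eq_square)
  also have "\<dots> = complex_of_real ((real p)\<^sup>2 * (\<Sum>w\<in>W. real (card {v \<in> W. int p dvd s w - s v \<and> int p dvd t w - t v})))"
    using assms by (simp add: sum.If_cases sum_distrib_left Int_def mult.commute)
  finally show ?thesis
    unfolding of_real_eq_iff .
qed

text \<open>Equal sums and equal reciprocal sums force equal products, provided the common sum is
  invertible; the two pairs are then the roots of one quadratic.\<close>

lemma quadruple_solutions:
  assumes x: "x1 \<in> U" "x2 \<in> U" and y: "y1 \<in> U" "y2 \<in> U"
    and 1: "int p dvd (x1 + x2) - (y1 + y2)"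
    and 2: "int p dvd (recip x1 + recip x2) - (recip y1 + recip y2)"
    and nz: "\<not> int p dvd x1 + x2"
  shows "(y1, y2) = (x1, x2) \<or> (y1, y2) = (x2, x1)"
proof -
  let ?i = recip
  have c1: "[(x1 + x2) = (y1 + y2)] (mod int p)" and c2: "[?i x1 + ?i x2 = ?i y1 + ?i y2] (mod int p)"
    using 1 2 by (simp_all add: cong_iff_dvd_diff)
  have ci: "[z * ?i z = 1] (mod int p)" if "z \<in> U" for z
    using dvd_recip[OF that] by (simp add: cong_iff_dvd_diff)
  \<comment> \<open>Clearing denominators in the reciprocal equation gives
    \<open>(x1 + x2) * y1 * y2 = (y1 + y2) * x1 * x2\<close> modulo \<open>p\<close>.\<close>
  have "[(x1 + x2) * (y1 * y2) = ((x1 * ?i x1) * x2 + (x2 * ?i x2) * x1) * (y1 * y2)] (mod int p)"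
    using cong_mult[OF cong_add[OF cong_mult[OF ci[OF x(1)] cong_refl[of x2]] cong_mult[OF ci[OF x(2)] cong_refl[of x1]]] cong_refl[of "y1 * y2"]]
    by (simp add: cong_sym add.commute)
  also have "((x1 * ?i x1) * x2 + (x2 * ?i x2) * x1) * (y1 * y2) = (?i x1 + ?i x2) * (x1 * x2 * y1 * y2)"
    by (simp add: algebra_simps)
  also have "[(?i x1 + ?i x2) * (x1 * x2 * y1 * y2) = (?i y1 + ?i y2) * (x1 * x2 * y1 * y2)] (mod int p)"
    by (intro cong_mult c2 cong_refl)
  also have "(?i y1 + ?i y2) * (x1 * x2 * y1 * y2) = ((y1 * ?i y1) * y2 + (y2 * ?i y2) * y1) * (x1 * x2)"
    by (simp add: algebra_simps)
  also have "[((y1 * ?i y1) * y2 + (y2 * ?i y2) * y1) * (x1 * x2) = (1 * y2 + 1 * y1) * (x1 * x2)] (mod int p)"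
    by (intro cong_mult cong_add ci y cong_refl)
  also have "(1 * y2 + 1 * y1) * (x1 * x2) = (y1 + y2) * (x1 * x2)" by simp
  also have "[(y1 + y2) * (x1 * x2) = (x1 + x2) * (x1 * x2)] (mod int p)"
    by (intro cong_mult cong_refl cong_sym[OF c1])
  finally have "int p dvd (x1 + x2) * (y1 * y2 - x1 * x2)"
    by (simp add: cong_iff_dvd_diff right_diff_distrib)
  then have "int p dvd y1 * y2 - x1 * x2"
    using dvd_mult_cancel[OF nz] by blast
  moreover have "int p dvd y1 * ((x1 + x2) - (y1 + y2))"
    using 1 by (rule dvd_mult)
  \<comment> \<open>The combination is the quadratic with roots \<open>x1\<close> and
    \<open>x2\<close>, evaluated at \<open>y1\<close>.\<close>
  ultimately have "int p dvd - (y1 * y2 - x1 * x2) - y1 * ((x1 + x2) - (y1 + y2))"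
    by (intro dvd_diff) (simp_all only: dvd_minus_iff)
  also have "- (y1 * y2 - x1 * x2) - y1 * ((x1 + x2) - (y1 + y2)) = (y1 - x1) * (y1 - x2)"
    by (simp add: algebra_simps)
  finally have "int p dvd y1 - x1 \<or> int p dvd y1 - x2"
    using prime_int_p prime_dvd_mult_iff by blast
  then have "y1 = x1 \<or> y1 = x2"
    using Z_cong_eq x y U_sub_Z by blast
  then have "y1 = x1 \<and> int p dvd x2 - y2 \<or> y1 = x2 \<and> int p dvd x1 - y2"
    using 1 by auto
  then show ?thesis
    using Z_cong_eq x y U_sub_Z by blast
qed

lemma kloosterman_square:
  "(kloosterman a b)\<^sup>2 = (\<Sum>w\<in>U \<times> U. e (a * (fst w + snd w) + b * (recip (fst w) + recip (snd w))))"
proof -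
  have "(kloosterman a b)\<^sup>2 = (\<Sum>x\<in>U. \<Sum>y\<in>U. e (a * (x + y) + b * (recip x + recip y)))"
    unfolding kloosterman_def power2_eq_square sum_product
    by (simp add: e_add[symmetric] algebra_simps)
  then show ?thesis by (simp add: sum.cartesian_product case_prod_unfold)
qed

text \<open>The moment is \<open>p^2\<close> times the number of pairs of pairs with equal sums and
  equal reciprocal sums. A pair with non-zero sum matches only itself and its swap; each of the at
  most \<open>p\<close> pairs with zero sum matches at most \<open>p\<close> others. Together this
  is at most \<open>2 * p^2 + p^2\<close>.\<close>

lemma sum_kloosterman_fourth: "(\<Sum>a\<in>Z. \<Sum>b\<in>Z. norm (kloosterman a b) ^ 4) \<le> 3 * real p ^ 4"
proof -
  define s t where "s w = fst w + snd w" and "t w = recip (fst w) + recip (snd w)" for w :: "int \<times> int"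
  let ?W = "U \<times> U"
  define E where "E w = {v \<in> ?W. int p dvd s w - s v \<and> int p dvd t w - t v}" for w
  define Y where "Y c = {v \<in> ?W. int p dvd c - s v}" for c
  have cU: "card U \<le> p" by simp
  have Y: "card (Y c) \<le> p" for c
  proof -
    have "inj_on fst (Y c)"
    proof (rule inj_onI)
      fix v w assume vw: "v \<in> Y c" "w \<in> Y c" "fst v = fst w"
      then have "int p dvd (c - s w) - (c - s v)" by (rule_tac dvd_diff) (auto simp: Y_def)
      then have "int p dvd snd v - snd w" using vw by (simp add: s_def)
      then have "snd v = snd w" using vw U_sub_Z by (intro Z_cong_eq) (auto simp: Y_def)
      then show "v = w" using vw by (simp add: prod_eq_iff)
    qed
    then have "card (Y c) \<le> card U" by (rule card_inj_on_le) (auto simp: Y_def)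
    then show ?thesis using cU by linarith
  qed
  have finY: "finite (Y c)" for c by (rule finite_subset[of _ ?W]) (auto simp: Y_def)
  have E: "card (E w) \<le> 2 + (if w \<in> Y 0 then p else 0)" if w: "w \<in> ?W" for w
  proof (cases "w \<in> Y 0")
    case True
    have "card (E w) \<le> card (Y (s w))" by (rule card_mono[OF finY]) (auto simp: E_def Y_def)
    then show ?thesis using Y[of "s w"] True by simp
  next
    case False
    have "E w \<subseteq> {w, (snd w, fst w)}"
    proof
      fix v assume v: "v \<in> E w"
      have "\<not> int p dvd fst w + snd w"
        using False w by (auto simp: Y_def s_def dvd_minus_iff[symmetric, of _ "fst w + snd w"])
      then have "(fst v, snd v) = (fst w, snd w) \<or> (fst v, snd v) = (snd w, fst w)"
        using v w by (intro quadruple_solutions) (auto simp: E_def s_def t_def)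
      then show "v \<in> {w, (snd w, fst w)}" by auto
    qed
    then have "card (E w) \<le> card {w, (snd w, fst w)}" by (intro card_mono) auto
    also have "\<dots> \<le> 2" by (simp add: card_insert_if)
    finally show ?thesis by simp
  qed
  have "(\<Sum>w\<in>?W. card (E w)) \<le> (\<Sum>w\<in>?W. 2 + (if w \<in> Y 0 then p else 0))"
    by (rule sum_mono[OF E])
  also have "\<dots> = 2 * card ?W + p * card (Y 0)"
  proof -
    have "?W \<inter> Y 0 = Y 0" by (auto simp: Y_def)
    then have "(\<Sum>w\<in>?W. if w \<in> Y 0 then p else 0) = p * card (Y 0)"
      by (simp add: sum.If_cases)
    then show ?thesis
      by (simp only: sum.distrib sum_constant of_nat_id mult.commute)
  qed
  also have "\<dots> \<le> 2 * (p * p) + p * p"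
    using Y[of 0] cU by (intro add_mono mult_mono) (auto simp: card_cartesian_product mult_mono)
  finally have E': "(\<Sum>w\<in>?W. card (E w)) \<le> 3 * (p * p)" by simp
  have "(\<Sum>a\<in>Z. \<Sum>b\<in>Z. norm (kloosterman a b) ^ 4)
      = (\<Sum>a\<in>Z. \<Sum>b\<in>Z. (norm (\<Sum>w\<in>?W. e (a * s w + b * t w)))\<^sup>2)"
    unfolding s_def t_def kloosterman_square[symmetric] norm_power by simp
  also have "\<dots> = (real p)\<^sup>2 * (\<Sum>w\<in>?W. real (card (E w)))"
    unfolding E_def by (rule sum_square_e2) simp
  also have "\<dots> = (real p)\<^sup>2 * real (\<Sum>w\<in>?W. card (E w))" by simp
  also have "\<dots> \<le> (real p)\<^sup>2 * real (3 * (p * p))"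
    using E' by (intro mult_left_mono of_nat_mono) auto
  also have "\<dots> = 3 * real p ^ 4" by (simp add: power2_eq_square power4_eq_xxxx)
  finally show ?thesis .
qed

lemma kloosterman_mod: "kloosterman (a mod int p) (b mod int p) = kloosterman a b"
  unfolding kloosterman_def
proof (intro sum.cong refl)
  fix x
  have "int p dvd (a mod int p - a) * x + (b mod int p - b) * recip x"
    by (intro dvd_add dvd_mult2) (simp_all add: mod_eq_dvd_iff[symmetric])
  then show "e (a mod int p * x + b mod int p * recip x) = e (a * x + b * recip x)"
    by (simp add: e_eq_iff algebra_simps)
qed

lemma dvd_recip_mult:
  assumes "c \<in> U" "x \<in> U"
  shows "int p dvd recip (c * x mod int p) - recip c * recip x"
proof -
  let ?y = "c * x mod int p"
  have y: "?y \<in> U"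
    using assms U_not_dvd dvd_mult_cancel by (intro mod_in_U) blast
  have "[?y = c * x] (mod int p)" by simp
  have "[?y * recip ?y = 1] (mod int p)" "[c * recip c = 1] (mod int p)" "[x * recip x = 1] (mod int p)"
    using assms y dvd_recip by (simp_all add: cong_iff_dvd_diff)
  then have "[?y * recip ?y = (c * recip c) * (x * recip x)] (mod int p)"
    using cong_mult[of "c * recip c" 1 "int p" "x * recip x" 1] by (metis cong_sym cong_trans mult_1)
  moreover have "[(c * recip c) * (x * recip x) = ?y * (recip c * recip x)] (mod int p)"
    using cong_mult[OF cong_sym[OF \<open>[?y = c * x] (mod int p)\<close>] cong_refl[of "recip c * recip x"]]
    by (simp only: mult_ac)
  ultimately have "[?y * recip ?y = ?y * (recip c * recip x)] (mod int p)"
    by (rule cong_trans)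
  then have "int p dvd ?y * (recip ?y - recip c * recip x)"
    by (simp only: cong_iff_dvd_diff right_diff_distrib)
  then show ?thesis using dvd_mult_cancel[OF U_not_dvd[OF y]] by blast
qed

text \<open>Multiplication by \<open>c\<close> permutes the non-zero residues and divides their
  inverses by \<open>c\<close>.\<close>

lemma kloosterman_dilate:
  assumes c: "c \<in> U"
  shows "kloosterman (a * c) (b * recip c) = kloosterman a b"
proof -
  have cop: "coprime c (int p)" using U_not_dvd[OF c] coprime_p_iff by blast
  have "inj_on (\<lambda>x. c * x mod int p) U"
    using inj_on_affine_mod[OF cop, of 0] U_sub_Z by (auto intro: inj_on_subset)
  moreover have "(\<lambda>x. c * x mod int p) ` U \<subseteq> U"
    using c U_not_dvd dvd_mult_cancel by (intro image_subsetI mod_in_U) blast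
  ultimately have "bij_betw (\<lambda>x. c * x mod int p) U U"
    unfolding bij_betw_def using endo_inj_surj[of U "\<lambda>x. c * x mod int p"] by auto
  then have "kloosterman a b = (\<Sum>x\<in>U. e (a * (c * x mod int p) + b * recip (c * x mod int p)))"
    unfolding kloosterman_def by (rule sum.reindex_bij_betw[symmetric])
  also have "\<dots> = (\<Sum>x\<in>U. e (a * c * x + b * recip c * recip x))"
  proof (intro sum.cong refl)
    fix x assume x: "x \<in> U"
    have "int p dvd a * (c * x mod int p - c * x) + b * (recip (c * x mod int p) - recip c * recip x)"
      using dvd_recip_mult[OF c x] by (intro dvd_add dvd_mult) (simp_all add: mod_eq_dvd_iff[symmetric])
    then show "e (a * (c * x mod int p) + b * recip (c * x mod int p)) = e (a * c * x + b * recip c * recip x)"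
      by (simp add: e_eq_iff algebra_simps)
  qed
  finally show ?thesis by (simp add: kloosterman_def)
qed

text \<open>The orbit of \<open>(a, b)\<close> under \<open>(a, b) \<mapsto> (a c, b / c)\<close> contributes \<open>p - 1\<close> equal terms to the
  fourth moment.\<close>

lemma kloosterman_bound:
  assumes ab: "\<not> (int p dvd a \<and> int p dvd b)"
  shows "norm (kloosterman a b) ^ 4 \<le> 6 * real p ^ 3"
proof -
  define \<phi> where "\<phi> c = (a * c mod int p, b * recip c mod int p)" for c
  have inj: "inj_on \<phi> U"
  proof (rule inj_onI)
    fix c d assume cd: "c \<in> U" "d \<in> U" "\<phi> c = \<phi> d"
    then have "int p dvd a * c - a * d" "int p dvd b * recip c - b * recip d"
      by (simp_all add: \<phi>_def mod_eq_dvd_iff)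
    then have "int p dvd a * (c - d)" "int p dvd b * (recip c - recip d)"
      by (simp_all add: right_diff_distrib)
    \<comment> \<open>Whichever of \<open>a\<close> and \<open>b\<close> is non-zero modulo
      \<open>p\<close> lets \<open>c\<close> be recovered from its coordinate, so the orbit has full
      length.\<close>
    then have "int p dvd c - d \<or> int p dvd recip c - recip d"
      using ab dvd_mult_cancel by blast
    then have "c = d \<or> recip c = recip d"
      using Z_cong_eq cd recip_U U_sub_Z by blast
    then show "c = d" using inj_on_recip cd by (auto dest: inj_onD)
  qed
  have "real (card U) * norm (kloosterman a b) ^ 4 = (\<Sum>c\<in>U. norm (kloosterman (a * c) (b * recip c)) ^ 4)"
    by (simp add: kloosterman_dilate)
  also have "\<dots> = (\<Sum>c\<in>U. norm (kloosterman (fst (\<phi> c)) (snd (\<phi> c))) ^ 4)"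
    by (simp add: \<phi>_def kloosterman_mod)
  also have "\<dots> = (\<Sum>z\<in>\<phi> ` U. norm (kloosterman (fst z) (snd z)) ^ 4)"
    by (simp add: sum.reindex[OF inj])
  also have "\<dots> \<le> (\<Sum>z\<in>Z \<times> Z. norm (kloosterman (fst z) (snd z)) ^ 4)"
    by (rule sum_mono2) (auto simp: \<phi>_def)
  also have "\<dots> \<le> 3 * real p ^ 4"
    using sum_kloosterman_fourth by (simp add: sum.cartesian_product case_prod_unfold)
  finally have "real (card U) * norm (kloosterman a b) ^ 4 \<le> 3 * real p ^ 4" .
  \<comment> \<open>Since \<open>p - 1\<close> is at least \<open>p / 2\<close>, dividing the fourth
    moment by the orbit length turns 3 into 6.\<close>
  moreover have "real p / 2 \<le> real (card U)" using p_ge_2 by simp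
  ultimately have "real p / 2 * norm (kloosterman a b) ^ 4 \<le> 3 * real p ^ 4"
    by (meson mult_right_mono norm_ge_zero order_trans zero_le_power)
  then have "real p * norm (kloosterman a b) ^ 4 \<le> real p * (6 * real p ^ 3)"
    by (simp add: power4_eq_xxxx power3_eq_cube)
  then show ?thesis by simp
qed

subsection \<open>Functions of bounded Wiener norm\<close>

text \<open>The norm of the Fourier algebra, phrased as the existence of an expansion: closure
  properties are then shown by exhibiting coefficients.\<close>

definition wiener :: "real \<Rightarrow> (int \<Rightarrow> real) \<Rightarrow> bool" where
  "wiener M f \<longleftrightarrow> (\<exists>c. (\<forall>x. complex_of_real (f x) = (\<Sum>r\<in>Z. c r * e (r * x))) \<and> (\<Sum>r\<in>Z. norm (c r)) \<le> M)"

lemma wiener_one: "wiener 1 (\<lambda>_. 1)"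
proof -
  have "(if r = 0 then 1 else 0) * e (r * x) = (if r = 0 then 1 else 0)" for r x
    by simp
  then show ?thesis
    unfolding wiener_def
    by (intro exI[of _ "\<lambda>r. if r = 0 then 1 else 0"])
       (simp only: if_distrib[of norm] norm_one norm_zero sum.delta finite_atLeastLessThan_int, simp)
qed

lemma wiener_diff:
  assumes "wiener M f" "wiener M' g"
  shows "wiener (M + M') (\<lambda>x. f x - g x)"
proof -
  from assms obtain c d where c: "\<And>x. complex_of_real (f x) = (\<Sum>r\<in>Z. c r * e (r * x))" "(\<Sum>r\<in>Z. norm (c r)) \<le> M"
    and d: "\<And>x. complex_of_real (g x) = (\<Sum>r\<in>Z. d r * e (r * x))" "(\<Sum>r\<in>Z. norm (d r)) \<le> M'"
    unfolding wiener_def by blast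
  have "(\<Sum>r\<in>Z. norm (c r - d r)) \<le> (\<Sum>r\<in>Z. norm (c r) + norm (d r))"
    by (intro sum_mono norm_triangle_ineq4)
  also have "\<dots> \<le> M + M'"
    unfolding sum.distrib using c(2) d(2) by (rule add_mono)
  finally show ?thesis
    unfolding wiener_def using c(1) d(1)
    by (intro exI[of _ "\<lambda>r. c r - d r"]) (simp add: left_diff_distrib sum_subtractf)
qed

text \<open>The coefficients of a product are the cyclic convolution of the coefficients, and the
  absolute sum of a convolution is at most the product of the absolute sums.\<close>

lemma wiener_mult:
  assumes "wiener M f" "wiener M' g"
  shows "wiener (M * M') (\<lambda>x. f x * g x)"
proof -
  from assms obtain c d where c: "\<And>x. complex_of_real (f x) = (\<Sum>r\<in>Z. c r * e (r * x))" "(\<Sum>r\<in>Z. norm (c r)) \<le> M"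
    and d: "\<And>x. complex_of_real (g x) = (\<Sum>r\<in>Z. d r * e (r * x))" "(\<Sum>r\<in>Z. norm (d r)) \<le> M'"
    unfolding wiener_def by blast
  define h where "h t = (\<Sum>r\<in>Z. c r * d ((t - r) mod int p))" for t
  have "complex_of_real (f x * g x) = (\<Sum>t\<in>Z. h t * e (t * x))" for x
  proof -
    have "(\<Sum>t\<in>Z. h t * e (t * x)) = (\<Sum>r\<in>Z. \<Sum>t\<in>Z. c r * d ((t - r) mod int p) * e (t * x))"
      unfolding h_def sum_distrib_right by (rule sum.swap)
    also have "\<dots> = (\<Sum>r\<in>Z. c r * e (r * x) * (\<Sum>t\<in>Z. d t * e (t * x)))"
    proof (rule sum.cong[OF refl])
      fix r
      have "periodic (\<lambda>t. d (t mod int p) * e (t * x))"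
        using periodic_e[of x 0] by (simp add: periodic_def mult.commute)
      from sum_shift_minus[OF this, of r]
      have "(\<Sum>t\<in>Z. d ((t - r) mod int p) * e ((t - r) * x)) = (\<Sum>t\<in>Z. d t * e (t * x))"
        by simp
      moreover have "d ((t - r) mod int p) * e (t * x) = e (r * x) * (d ((t - r) mod int p) * e ((t - r) * x))" for t
      proof -
        have "e (t * x) = e (r * x) * e ((t - r) * x)"
          by (simp add: e_add[symmetric] algebra_simps)
        then show ?thesis by simp
      qed
      ultimately show "(\<Sum>t\<in>Z. c r * d ((t - r) mod int p) * e (t * x)) = c r * e (r * x) * (\<Sum>t\<in>Z. d t * e (t * x))"
        by (simp only: mult.assoc sum_distrib_left[symmetric])
    qed
    also have "\<dots> = complex_of_real (f x * g x)"
      unfolding of_real_mult c(1) d(1) by (rule sum_distrib_right[symmetric])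
    finally show ?thesis by simp
  qed
  moreover have "(\<Sum>t\<in>Z. norm (h t)) \<le> M * M'"
  proof -
    have "(\<Sum>t\<in>Z. norm (h t)) \<le> (\<Sum>t\<in>Z. \<Sum>r\<in>Z. norm (c r) * norm (d ((t - r) mod int p)))"
      unfolding h_def by (intro sum_mono order.trans[OF norm_sum]) (simp add: norm_mult)
    also have "\<dots> = (\<Sum>r\<in>Z. norm (c r) * (\<Sum>t\<in>Z. norm (d ((t - r) mod int p))))"
      unfolding sum_distrib_left by (rule sum.swap)
    also have "\<dots> = (\<Sum>r\<in>Z. norm (c r) * (\<Sum>t\<in>Z. norm (d t)))"
    proof (rule sum.cong[OF refl])
      fix r
      have "periodic (\<lambda>t. norm (d (t mod int p)))" by (simp add: periodic_def)
      from sum_shift_minus[OF this, of r]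
      show "norm (c r) * (\<Sum>t\<in>Z. norm (d ((t - r) mod int p))) = norm (c r) * (\<Sum>t\<in>Z. norm (d t))"
        by simp
    qed
    also have "\<dots> \<le> M * M'"
      unfolding sum_distrib_right[symmetric] using c(2) d(2)
      by (intro mult_mono) (auto intro: sum_nonneg order.trans[OF sum_nonneg c(2)])
    finally show ?thesis .
  qed
  ultimately show ?thesis unfolding wiener_def by blast
qed

lemma wiener_power: "wiener M f \<Longrightarrow> wiener (M ^ m) (\<lambda>x. f x ^ m)"
  by (induction m) (simp_all add: wiener_one wiener_mult)

lemma wiener_mono: "wiener M f \<Longrightarrow> M \<le> M' \<Longrightarrow> wiener M' f"
  unfolding wiener_def by (meson order_trans)

text \<open>The multiplier \<open>|S Q r|^2\<close> sums to \<open>p * card Q\<close> by Parseval,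
  and \<open>S A\<close> is bounded trivially by \<open>p\<close>. As \<open>Q\<close> has density
  bounded below, the resulting norm does not grow with \<open>p\<close>.\<close>

lemma wiener_smooth:
  assumes A: "A \<subseteq> Z" and Q: "Q \<subseteq> Z" "Q \<noteq> {}"
  shows "wiener (real p / real (card Q)) (smooth Q A)"
proof -
  let ?q = "real (card Q)"
  have q: "0 < ?q" using Q finite_sub[OF Q(1)] by (simp add: card_gt_0_iff)
  define c where "c r = S A (- r) * (S Q r * S Q (- r)) / complex_of_real (real p * ?q\<^sup>2)" for r
  have "complex_of_real (smooth Q A x) = (\<Sum>r\<in>Z. c r * e (r * x))" for x
  proof -
    have "complex_of_real (\<Sum>d\<in>Q \<times> Q. ind A (x + (fst d - snd d)))
        = (\<Sum>d\<in>Q \<times> Q. \<Sum>r\<in>Z. S A (- r) * e (r * (x + (fst d - snd d)))) / of_nat p"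
      by (simp add: ind_expansion[OF A] sum_divide_distrib)
    also have "(\<Sum>d\<in>Q \<times> Q. \<Sum>r\<in>Z. S A (- r) * e (r * (x + (fst d - snd d))))
        = (\<Sum>r\<in>Z. \<Sum>d\<in>Q \<times> Q. S A (- r) * e (r * (x + (fst d - snd d))))"
      by (rule sum.swap)
    also have "\<dots> = (\<Sum>r\<in>Z. S A (- r) * (S Q r * S Q (- r)) * e (r * x))"
    proof (rule sum.cong[OF refl])
      fix r
      have "S Q r * S Q (- r) = (\<Sum>d\<in>Q \<times> Q. e (r * (fst d - snd d)))"
        unfolding S_def sum_product e_add[symmetric] sum.cartesian_product
        by (simp add: case_prod_unfold algebra_simps)
      then show "(\<Sum>d\<in>Q \<times> Q. S A (- r) * e (r * (x + (fst d - snd d)))) = S A (- r) * (S Q r * S Q (- r)) * e (r * x)"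
        by (simp add: sum_distrib_left sum_distrib_right distrib_left e_add mult_ac)
    qed
    finally show ?thesis
      unfolding smooth_def c_def of_real_divide by (simp add: sum_divide_distrib)
  qed
  moreover have "(\<Sum>r\<in>Z. norm (c r)) \<le> real p / ?q"
  proof -
    have "(\<Sum>r\<in>Z. norm (c r)) \<le> (\<Sum>r\<in>Z. (norm (S Q r))\<^sup>2 / ?q\<^sup>2)"
    proof (rule sum_mono)
      fix r
      have "norm (S A (- r)) \<le> real p"
        using norm_S_le[of A "- r"] card_le_p[OF A] by linarith
      then have "norm (S A (- r)) * (norm (S Q r))\<^sup>2 \<le> real p * (norm (S Q r))\<^sup>2"
        by (rule mult_right_mono) simp
      then have "norm (S A (- r)) * (norm (S Q r))\<^sup>2 / (real p * ?q\<^sup>2) \<le> real p * (norm (S Q r))\<^sup>2 / (real p * ?q\<^sup>2)"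
        by (rule divide_right_mono) simp
      moreover have "norm (c r) = norm (S A (- r)) * (norm (S Q r))\<^sup>2 / (real p * ?q\<^sup>2)"
        unfolding c_def norm_divide norm_mult norm_S_minus norm_of_real by (simp add: power2_eq_square)
      ultimately show "norm (c r) \<le> (norm (S Q r))\<^sup>2 / ?q\<^sup>2"
        by simp
    qed
    also have "\<dots> = real p / ?q"
      unfolding sum_divide_distrib[symmetric] parseval[OF Q(1)] using q by (simp add: power2_eq_square)
    finally show ?thesis .
  qed
  ultimately show ?thesis unfolding wiener_def by blast
qed

text \<open>Functions of bounded Wiener norm cannot correlate with the inversion map beyond their means,
  because only the zero frequencies give a large Kloosterman sum.\<close>

lemma wiener_correlation:
  assumes f: "wiener M f" "\<And>x. 0 \<le> f x" and g: "wiener M' g" "\<And>x. 0 \<le> g x"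
    and l: "\<not> int p dvd l"
    and K: "\<And>a b. \<not> (int p dvd a \<and> int p dvd b) \<Longrightarrow> norm (kloosterman a b) \<le> K"
  shows "(\<Sum>x\<in>U. f x * g (l * recip x)) \<le> (\<Sum>x\<in>Z. f x) * (\<Sum>x\<in>Z. g x) / real p + M * M' * K"
proof -
  from f(1) obtain c where c: "\<And>x. complex_of_real (f x) = (\<Sum>r\<in>Z. c r * e (r * x))" "(\<Sum>r\<in>Z. norm (c r)) \<le> M"
    unfolding wiener_def by blast
  from g(1) obtain d where d: "\<And>x. complex_of_real (g x) = (\<Sum>r\<in>Z. d r * e (r * x))" "(\<Sum>r\<in>Z. norm (d r)) \<le> M'"
    unfolding wiener_def by blast
  have mean: "c' 0 = complex_of_real (\<Sum>x\<in>Z. h x) / of_nat p"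
    if "\<And>x. complex_of_real (h x) = (\<Sum>r\<in>Z. c' r * e (r * x))" for c' h
  proof -
    have "complex_of_real (\<Sum>x\<in>Z. h x) = (\<Sum>r\<in>Z. \<Sum>x\<in>Z. c' r * e (r * x))"
      unfolding of_real_sum that by (rule sum.swap)
    also have "\<dots> = (\<Sum>r\<in>Z. if r = 0 then c' 0 * of_nat p else 0)"
    proof (rule sum.cong[OF refl])
      fix r assume "r \<in> Z"
      then have "int p dvd r \<longleftrightarrow> r = 0" using Z_not_dvd[of r] by auto
      then show "(\<Sum>x\<in>Z. c' r * e (r * x)) = (if r = 0 then c' 0 * of_nat p else 0)"
        by (simp add: sum_distrib_left[symmetric] sum_e)
    qed
    also have "\<dots> = c' 0 * of_nat p" by simp
    finally show ?thesis by simp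
  qed
  \<comment> \<open>The main term: both frequencies zero give the trivial sum over \<open>U\<close>.
    All other pairs, including those with exactly one zero frequency, fall under the bound
    \<open>K\<close> because \<open>l\<close> is invertible.\<close>
  define m where "m r s = (if r = 0 \<and> s = 0 then of_nat (card U) else 0 :: complex)" for r s :: int
  have K0: "0 \<le> K"
    using K[of 1 0] p_ge_2 by (force intro: order.trans[OF norm_ge_zero])
  have Km: "norm (kloosterman r (l * s) - m r s) \<le> K" if "r \<in> Z" "s \<in> Z" for r s
  proof (cases "r = 0 \<and> s = 0")
    case True
    then show ?thesis using K0 by (simp add: m_def kloosterman_def)
  next
    case False
    then have "\<not> (int p dvd r \<and> int p dvd l * s)"
      using that Z_not_dvd dvd_mult_cancel[OF l] by blast
    from K[OF this] show ?thesis using False by (auto simp: m_def)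
  qed
  have "complex_of_real (\<Sum>x\<in>U. f x * g (l * recip x))
      = (\<Sum>x\<in>U. \<Sum>r\<in>Z. \<Sum>s\<in>Z. c r * d s * e (r * x + l * s * recip x))"
    by (simp add: c(1) d(1) sum_product e_add mult_ac)
  also have "\<dots> = (\<Sum>r\<in>Z. \<Sum>x\<in>U. \<Sum>s\<in>Z. c r * d s * e (r * x + l * s * recip x))"
    by (rule sum.swap)
  also have "\<dots> = (\<Sum>r\<in>Z. \<Sum>s\<in>Z. \<Sum>x\<in>U. c r * d s * e (r * x + l * s * recip x))"
    by (rule sum.cong[OF refl], rule sum.swap)
  also have "\<dots> = (\<Sum>r\<in>Z. \<Sum>s\<in>Z. c r * d s * m r s) + (\<Sum>r\<in>Z. \<Sum>s\<in>Z. c r * d s * (kloosterman r (l * s) - m r s))"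
    by (simp add: kloosterman_def sum_distrib_left[symmetric] sum.distrib[symmetric] right_diff_distrib)
  also have "(\<Sum>r\<in>Z. \<Sum>s\<in>Z. c r * d s * m r s) = c 0 * d 0 * of_nat (card U)"
  proof -
    have "(\<Sum>s\<in>Z. c r * d s * m r s) = (if r = 0 then c 0 * d 0 * of_nat (card U) else 0)" for r
    proof -
      have "(\<Sum>s\<in>Z. c r * d s * m r s) = (\<Sum>s\<in>Z. if s = 0 then (if r = 0 then c 0 * d 0 * of_nat (card U) else 0) else 0)"
        by (rule sum.cong) (auto simp: m_def)
      then show ?thesis by simp
    qed
    then show ?thesis by simp
  qed
  finally have eq: "complex_of_real (\<Sum>x\<in>U. f x * g (l * recip x)) = complex_of_real ((\<Sum>x\<in>Z. f x) / real p * ((\<Sum>x\<in>Z. g x) / real p) * real (card U))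
      + (\<Sum>r\<in>Z. \<Sum>s\<in>Z. c r * d s * (kloosterman r (l * s) - m r s))"
    unfolding mean[OF c(1)] mean[OF d(1)] by simp
  have err: "norm (\<Sum>r\<in>Z. \<Sum>s\<in>Z. c r * d s * (kloosterman r (l * s) - m r s)) \<le> M * M' * K"
  proof -
    have "norm (\<Sum>r\<in>Z. \<Sum>s\<in>Z. c r * d s * (kloosterman r (l * s) - m r s)) \<le> (\<Sum>r\<in>Z. \<Sum>s\<in>Z. norm (c r) * norm (d s) * K)"
      using Km by (intro order.trans[OF norm_sum] sum_mono) (auto simp: norm_mult intro!: mult_left_mono)
    also have "\<dots> = (\<Sum>r\<in>Z. norm (c r)) * (\<Sum>s\<in>Z. norm (d s)) * K"
      by (simp only: sum_distrib_left[symmetric] sum_distrib_right[symmetric])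
    also have "\<dots> \<le> M * M' * K"
      using c(2) d(2) K0 by (intro mult_right_mono mult_mono) (auto intro: sum_nonneg order.trans[OF sum_nonneg c(2)])
    finally show ?thesis .
  qed
  have "(\<Sum>x\<in>U. f x * g (l * recip x)) = (\<Sum>x\<in>Z. f x) / real p * ((\<Sum>x\<in>Z. g x) / real p) * real (card U)
      + Re (\<Sum>r\<in>Z. \<Sum>s\<in>Z. c r * d s * (kloosterman r (l * s) - m r s))"
    using arg_cong[OF eq, of Re] by (simp only: Re_complex_of_real plus_complex.sel)
  also have "\<dots> \<le> (\<Sum>x\<in>Z. f x) / real p * ((\<Sum>x\<in>Z. g x) / real p) * real p + M * M' * K"
  proof (rule add_mono)
    show "(\<Sum>x\<in>Z. f x) / real p * ((\<Sum>x\<in>Z. g x) / real p) * real (card U) \<le> (\<Sum>x\<in>Z. f x) / real p * ((\<Sum>x\<in>Z. g x) / real p) * real p"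
      using f(2) g(2) by (intro mult_left_mono mult_nonneg_nonneg divide_nonneg_nonneg sum_nonneg) auto
  qed (rule order.trans[OF complex_Re_le_cmod err])
  also have "\<dots> = (\<Sum>x\<in>Z. f x) * (\<Sum>x\<in>Z. g x) / real p + M * M' * K"
    by simp
  finally show ?thesis .
qed

subsection \<open>The density bound\<close>

text \<open>Pollard bounds from below the total of the representation counts truncated at
  \<open>t\<close>. Residues outside \<open>Y\<close> account for at most \<open>t\<close> each, so
  the rest must come from sums that land in \<open>Y\<close>.\<close>

lemma popular_sums:
  assumes X: "X \<subseteq> Z" and Y: "Y \<subseteq> Z" and t: "t \<le> card X"
  shows "real t * min (real (card Y)) (2 * real (card X) + real (card Y) - real p - real t)
    \<le> (\<Sum>x\<in>X. \<Sum>y\<in>X. ind Y (x + y))"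
proof -
  have fin: "finite X" "finite Y" using X Y finite_sub by auto
  have "(\<Sum>c\<in>Y. real (rep X X c)) = (\<Sum>c\<in>Z. ind Y c * (\<Sum>b\<in>X. ind X (c - b)))"
    unfolding sum_ind[OF Y] using fin by (simp add: rep_conv_sum)
  also have "\<dots> = (\<Sum>b\<in>X. \<Sum>c\<in>Z. ind Y c * ind X (c - b))"
    unfolding sum_distrib_left by (rule sum.swap)
  also have "\<dots> = (\<Sum>b\<in>X. \<Sum>c\<in>Z. ind X c * ind Y (c + b))"
  proof (rule sum.cong[OF refl])
    fix b
    have "periodic (\<lambda>c. ind X c * ind Y (c + b))"
      by (rule periodicI) (simp only: ind_mod ind_mod(1)[where b = 0, simplified])
    from sum_shift_minus[OF this, of b]
    show "(\<Sum>c\<in>Z. ind Y c * ind X (c - b)) = (\<Sum>c\<in>Z. ind X c * ind Y (c + b))"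
      by (simp add: mult.commute)
  qed
  also have "\<dots> = (\<Sum>x\<in>X. \<Sum>y\<in>X. ind Y (x + y))"
    by (simp add: sum_ind[OF X] add.commute)
  finally have T: "(\<Sum>c\<in>Y. real (rep X X c)) = (\<Sum>x\<in>X. \<Sum>y\<in>X. ind Y (x + y))" .
  have "t * min p (card X + card X - t) \<le> (\<Sum>c\<in>Z. min t (rep X X c))"
    by (rule pollard[OF X X t t])
  also have "\<dots> = (\<Sum>c\<in>Y. min t (rep X X c)) + (\<Sum>c\<in>Z - Y. min t (rep X X c))"
    using Y by (subst sum.subset_diff[of Y Z]) auto
  also have "\<dots> \<le> (\<Sum>c\<in>Y. rep X X c) + (\<Sum>c\<in>Z - Y. t)"
    by (intro add_mono sum_mono) auto
  also have "\<dots> = (\<Sum>c\<in>Y. rep X X c) + (p - card Y) * t"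
    using Y fin by (simp add: card_Diff_subset)
  finally have "real (t * min p (card X + card X - t)) \<le> real ((\<Sum>c\<in>Y. rep X X c) + (p - card Y) * t)"
    by (rule of_nat_mono)
  moreover have "real (p - card Y) = real p - real (card Y)"
    using card_le_p[OF Y] by (rule of_nat_diff)
  moreover have "real (min p (card X + card X - t)) = min (real p) (2 * real (card X) - real t)"
    using t by (simp add: of_nat_diff of_nat_min)
  ultimately have "real t * min (real p) (2 * real (card X) - real t) - (real p - real (card Y)) * real t \<le> (\<Sum>x\<in>X. \<Sum>y\<in>X. ind Y (x + y))"
    using T by simp
  moreover have "min (real (card Y)) (2 * real (card X) + real (card Y) - real p - real t)
      = min (real p) (2 * real (card X) - real t) - (real p - real (card Y))"
    by (simp add: min_def)
  ultimately show ?thesis by (simp only: right_diff_distrib mult.commute)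
qed

text \<open>The amplified function never exceeds 1, and by Bernoulli it is at most
  \<open>m * f x\<close>, hence below \<open>\<tau>\<close> wherever
  \<open>f x < \<tau> / m\<close>.\<close>

lemma sum_amplified_le:
  assumes f: "\<And>x. 0 \<le> f x" "\<And>x. f x \<le> 1" and m: "0 < m" and \<tau>: "0 \<le> \<tau>"
  shows "(\<Sum>x\<in>Z. 1 - (1 - f x) ^ m) \<le> real (card {x \<in> Z. \<tau> / real m \<le> f x}) + \<tau> * real p"
proof -
  have "1 - (1 - f x) ^ m \<le> of_bool (\<tau> / real m \<le> f x) + \<tau>" for x
  proof (cases "\<tau> / real m \<le> f x")
    case True
    have "0 \<le> (1 - f x) ^ m" using f by simp
    with True \<tau> show ?thesis by simp
  next
    case False
    have "1 + real m * (- f x) \<le> (1 + - f x) ^ m"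
      using f(2)[of x] by (intro Bernoulli_inequality) simp
    moreover have "real m * f x < \<tau>" using False m by (simp add: field_simps)
    ultimately show ?thesis using False by simp
  qed
  then have "(\<Sum>x\<in>Z. 1 - (1 - f x) ^ m) \<le> (\<Sum>x\<in>Z. of_bool (\<tau> / real m \<le> f x) + \<tau>)"
    by (intro sum_mono)
  also have "\<dots> = real (card {x \<in> Z. \<tau> / real m \<le> f x}) + \<tau> * real p"
    unfolding sum.distrib by (simp add: of_bool_def sum.If_cases Int_def mult.commute)
  finally show ?thesis .
qed

text \<open>With \<open>t\<close> close to \<open>\<tau> * p\<close>, so few sums from
  \<open>X\<close> in \<open>Y\<close> force the minimum in the popular-sums bound below
  \<open>\<tau> * p / 2\<close>. So \<open>X\<close> is small, \<open>Y\<close> is small, or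
  \<open>2|X| + |Y|\<close> hardly exceeds \<open>p\<close>: the three alternatives of
  \<open>level_product_le\<close>.\<close>

lemma popular_product_le:
  assumes \<tau>: "0 < \<tau>" "\<tau> \<le> 1 / 20" and p: "2 \<le> \<tau> * real p" and X: "X \<subseteq> Z" and Y: "Y \<subseteq> Z"
    and few: "(\<Sum>x\<in>X. \<Sum>y\<in>X. ind Y (x + y)) \<le> \<tau>\<^sup>2 / 4 * (real p)\<^sup>2"
  shows "(real (card X) + \<tau> * real p) * (real (card Y) + \<tau> * real p) \<le> (1 + 5 * \<tau>)\<^sup>2 / 8 * (real p)\<^sup>2"
proof (rule level_product_le[OF \<tau>])
  \<comment> \<open>The assumption \<open>2 \<le> \<tau> * real p\<close> ensures that rounding down
    costs at most half of \<open>\<tau> * p\<close>; the bound on \<open>few\<close> is the square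
    of that half.\<close>
  define t where "t = nat \<lfloor>\<tau> * real p\<rfloor>"
  have t: "real t \<le> \<tau> * real p" "\<tau> * real p / 2 \<le> real t"
    using p unfolding t_def by linarith+
  have cX: "real (card X) \<le> real p" and cY: "real (card Y) \<le> real p"
    using card_le_p X Y by auto
  show "real (card X) \<le> \<tau> * real p \<and> real (card Y) \<le> real p \<or> real (card Y) \<le> \<tau> * real p \<and> real (card X) \<le> real p \<or>
      2 * real (card X) + real (card Y) \<le> (1 + 2 * \<tau>) * real p"
  proof (cases "t \<le> card X")
    case False
    then have "real (card X) \<le> real t" by simp
    with t cY show ?thesis by linarith
  next
    case True
    define \<mu> where "\<mu> = min (real (card Y)) (2 * real (card X) + real (card Y) - real p - real t)"
    have "real t * \<mu> \<le> \<tau>\<^sup>2 / 4 * (real p)\<^sup>2"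
      using popular_sums[OF X Y True] few unfolding \<mu>_def by linarith
    also have "\<dots> = (\<tau> * real p / 2) * (\<tau> * real p / 2)"
      by (simp add: power2_eq_square)
    also have "\<dots> \<le> real t * (\<tau> * real p / 2)"
      using t p by (intro mult_right_mono) auto
    finally have "\<mu> \<le> \<tau> * real p / 2"
      using t p by (intro mult_left_le_imp_le[of "real t" \<mu>]) auto
    then have "real (card Y) \<le> \<tau> * real p / 2 \<or> 2 * real (card X) + real (card Y) - real p - real t \<le> \<tau> * real p / 2"
      unfolding \<mu>_def min_le_iff_disj .
    moreover have "(1 + 2 * \<tau>) * real p = real p + 2 * (\<tau> * real p)"
      by (simp add: algebra_simps)
    ultimately show ?thesis using t p cX by linarith
  qed
qed auto

text \<open>In the final bound, \<open>3 * \<tau>\<close> pays for the element 0 and the two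
  exceptional sets where a smoothed function is small; the extra \<open>\<tau>\<close> in the
  numerator is the Kloosterman error; the denominator arises because \<open>F\<close> and
  \<open>G\<close> reach only \<open>1 - \<tau>\<close> on the remaining points.\<close>

lemma card_le_of_not_represented:
  assumes \<tau>: "0 < \<tau>" "\<tau> \<le> 1 / 20" and m: "0 < m" "(1 - \<tau>) ^ m \<le> \<tau>"
    and \<kappa>: "\<kappa> = (\<tau> / real m) ^ 3 * (\<tau>\<^sup>2 / 4)"
    and N: "0 < N" "6 * pi / real N \<le> \<kappa>" and k: "4 / \<kappa>\<^sup>2 \<le> real k"
    and M: "M = 1 + (1 + real N ^ k) ^ m"
    and p: "2 \<le> \<tau> * real p" "6 * M ^ 8 \<le> \<tau> ^ 4 * real p"
    and A: "A \<subseteq> Z" and l: "\<not> int p dvd l"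
    and nsol: "\<And>x y z. x \<in> A \<Longrightarrow> y \<in> A \<Longrightarrow> z \<in> A \<Longrightarrow> \<not> int p dvd x * (y + z) - l"
  shows "real (card A) \<le> (3 * \<tau> + ((1 + 5 * \<tau>)\<^sup>2 / 8 + \<tau>) / (1 - \<tau>)\<^sup>2) * real p"
proof -
  define \<theta> where "\<theta> = \<tau> / real m"
  have \<theta>: "0 < \<theta>" "\<theta> \<le> 1"
    using \<tau> m by (auto simp: \<theta>_def field_simps)
  have \<kappa>01: "0 < \<kappa>" "\<kappa> \<le> 1"
  proof -
    show "0 < \<kappa>" using \<theta> \<tau> unfolding \<kappa> \<theta>_def[symmetric] by simp
    have "\<tau>\<^sup>2 \<le> 1" "\<theta> ^ 3 \<le> 1" using \<theta> \<tau> by (auto intro!: power_le_one)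
    then have "\<theta> ^ 3 * (\<tau>\<^sup>2 / 4) \<le> 1 * 1"
      using \<theta> by (intro mult_mono) auto
    then show "\<kappa> \<le> 1" unfolding \<kappa> \<theta>_def[symmetric] by simp
  qed
  \<comment> \<open>Zero is dropped because it has no inverse; \<open>B\<close> is then the set of
    quotients \<open>l / x\<close>.\<close>
  define A1 where "A1 = A \<inter> U"
  define \<beta> where "\<beta> x = l * recip x mod int p" for x
  define B where "B = \<beta> ` A1"
  have B: "B \<subseteq> Z" by (auto simp: B_def \<beta>_def)
  have inj: "inj_on \<beta> U"
  proof -
    have "inj_on ((\<lambda>y. (l * y + 0) mod int p) \<circ> recip) U"
    proof (rule comp_inj_on[OF inj_on_recip])
      show "inj_on (\<lambda>y. (l * y + 0) mod int p) (recip ` U)"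
      proof (rule inj_on_subset[OF inj_on_affine_mod])
        show "coprime l (int p)" using l by (simp add: coprime_p_iff)
        show "recip ` U \<subseteq> Z" using recip_U U_sub_Z by blast
      qed
    qed
    then show ?thesis by (simp add: \<beta>_def[abs_def] comp_def)
  qed
  have disj: "(y + z) mod int p \<notin> B" if "y \<in> A" "z \<in> A" for y z
  proof
    assume "(y + z) mod int p \<in> B"
    then obtain x where x: "x \<in> A" "x \<in> U" "(y + z) mod int p = l * recip x mod int p"
      by (auto simp: B_def A1_def \<beta>_def)
    have "int p dvd x * ((y + z) - l * recip x) + l * (x * recip x - 1)"
      using x dvd_recip[OF x(2)] by (intro dvd_add dvd_mult) (simp_all add: mod_eq_dvd_iff)
    then have "int p dvd x * (y + z) - l"
      by (simp add: algebra_simps)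
    with nsol x that show False by blast
  qed
  obtain Q where Q: "Q \<subseteq> Z" "Q \<noteq> {}" "real p \<le> real (card Q) * real N ^ k"
    "\<And>u1 v1 u2 v2 u3 v3. u1 \<in> Q \<Longrightarrow> v1 \<in> Q \<Longrightarrow> u2 \<in> Q \<Longrightarrow> v2 \<in> Q \<Longrightarrow> u3 \<in> Q \<Longrightarrow> v3 \<in> Q \<Longrightarrow>
      (\<Sum>y\<in>A. \<Sum>z\<in>A. ind B (y + z + ((u3 - v3) - (u1 - v1) - (u2 - v2)))) \<le> \<kappa> * (real p)\<^sup>2"
    by (rule almost_periods[OF \<kappa>01 N k A B disj]) blast+
  define f g where "f = smooth Q A" and "g = smooth Q B"
  have fg: "0 \<le> f x" "f x \<le> 1" "0 \<le> g x" "g x \<le> 1" for x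
    by (simp_all add: f_def g_def smooth_nonneg smooth_le_1)
  have g_mod: "g (x mod int p) = g x" for x
    using periodic_smooth[of Q B 0] by (simp add: g_def periodic_def)
  define F G where "F x = 1 - (1 - f x) ^ m" and "G x = 1 - (1 - g x) ^ m" for x
  have FG: "0 \<le> F x" "0 \<le> G x" for x
    using fg by (simp_all add: F_def G_def power_le_one)
  have q: "0 < real (card Q)" using Q finite_sub[OF Q(1)] by (simp add: card_gt_0_iff)
  have C: "real p / real (card Q) \<le> real N ^ k"
    using Q(3) q by (simp add: pos_divide_le_eq mult.commute)
  \<comment> \<open>The norm of \<open>1 - f\<close> is at most \<open>1 + N ^ k\<close>, its
    \<open>m\<close>-th power is bounded accordingly, and the outer \<open>1 -\<close> adds 1: this
    is \<open>M\<close>.\<close>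
  have wF: "wiener M F" and wG: "wiener M G"
    unfolding F_def[abs_def] G_def[abs_def] f_def g_def M
    by (intro wiener_diff wiener_one wiener_power wiener_mono[OF wiener_smooth C] A B Q)+
  define X Y where "X = {x \<in> Z. \<theta> \<le> f x}" and "Y = {x \<in> Z. \<theta> \<le> g x}"
  have XY: "X \<subseteq> Z" "Y \<subseteq> Z" by (auto simp: X_def Y_def)

  have "(\<Sum>x\<in>X. \<Sum>y\<in>X. ind Y (x + y)) \<le> \<tau>\<^sup>2 / 4 * (real p)\<^sup>2"
  proof -
    \<comment> \<open>Each of the three smoothed weights is at least \<open>\<theta>\<close> on its
      level set; the factor \<open>\<theta> ^ 3\<close> in \<open>\<kappa>\<close> was put there to
      cancel this loss.\<close>
    have "\<theta> ^ 3 * (\<Sum>x\<in>X. \<Sum>y\<in>X. ind Y (x + y)) = (\<Sum>x\<in>X. \<Sum>y\<in>X. \<theta> * \<theta> * (\<theta> * ind Y (x + y)))"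
      by (simp add: sum_distrib_left power3_eq_cube mult_ac)
    also have "\<dots> \<le> (\<Sum>x\<in>X. \<Sum>y\<in>X. f x * f y * g (x + y))"
    proof (intro sum_mono)
      fix x y assume "x \<in> X" "y \<in> X"
      moreover have "\<theta> * ind Y (x + y) \<le> g (x + y)"
        using fg \<theta> g_mod[of "x + y"] by (auto simp: ind_def Y_def)
      ultimately show "\<theta> * \<theta> * (\<theta> * ind Y (x + y)) \<le> f x * f y * g (x + y)"
        using \<theta> fg by (intro mult_mono) (auto simp: X_def)
    qed
    also have "\<dots> \<le> (\<Sum>x\<in>Z. \<Sum>y\<in>X. f x * f y * g (x + y))"
      using XY fg by (intro sum_mono2 sum_nonneg mult_nonneg_nonneg) auto
    also have "\<dots> \<le> (\<Sum>x\<in>Z. \<Sum>y\<in>Z. f x * f y * g (x + y))"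
      using XY fg by (intro sum_mono sum_mono2 mult_nonneg_nonneg) auto
    also have "\<dots> \<le> \<kappa> * (real p)\<^sup>2"
      unfolding f_def g_def by (rule sum_count_smooth_le[OF A Q(1,2,4)])
    finally have "\<theta> ^ 3 * (\<Sum>x\<in>X. \<Sum>y\<in>X. ind Y (x + y)) \<le> \<theta> ^ 3 * (\<tau>\<^sup>2 / 4 * (real p)\<^sup>2)"
      unfolding \<kappa> \<theta>_def by (simp only: mult.assoc)
    then show ?thesis by (rule mult_left_le_imp_le) (use \<theta> in simp)
  qed
  from popular_product_le[OF \<tau> p(1) XY this]
  have XY_le: "(real (card X) + \<tau> * real p) * (real (card Y) + \<tau> * real p) \<le> (1 + 5 * \<tau>)\<^sup>2 / 8 * (real p)\<^sup>2" .

  have "(\<Sum>x\<in>Z. F x) * (\<Sum>x\<in>Z. G x) \<le> (real (card X) + \<tau> * real p) * (real (card Y) + \<tau> * real p)"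
  proof (rule mult_mono)
    show "(\<Sum>x\<in>Z. F x) \<le> real (card X) + \<tau> * real p"
      unfolding F_def X_def \<theta>_def using fg m \<tau> by (intro sum_amplified_le) auto
    show "(\<Sum>x\<in>Z. G x) \<le> real (card Y) + \<tau> * real p"
      unfolding G_def Y_def \<theta>_def using fg m \<tau> by (intro sum_amplified_le) auto
  qed (use FG \<tau> in \<open>auto intro: sum_nonneg\<close>)
  with XY_le have prod_le: "(\<Sum>x\<in>Z. F x) * (\<Sum>x\<in>Z. G x) / real p \<le> (1 + 5 * \<tau>)\<^sup>2 / 8 * real p"
    by (simp add: pos_divide_le_eq power2_eq_square)

  have M1: "1 \<le> M" unfolding M by simp
  \<comment> \<open>The correlation error is \<open>M * M * K\<close>, so \<open>K\<close> must be
    \<open>\<tau> * p\<close> over \<open>M^2\<close>. Taking fourth powers for the Kloosterman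
    bound produces \<open>M ^ 8\<close> and \<open>\<tau> ^ 4\<close> in the condition on
    \<open>p\<close>.\<close>
  have K: "norm (kloosterman a b) \<le> \<tau> * real p / M\<^sup>2" if "\<not> (int p dvd a \<and> int p dvd b)" for a b
  proof -
    have "norm (kloosterman a b) ^ 4 * M ^ 8 \<le> (6 * real p ^ 3) * M ^ 8"
      using M1 by (intro mult_right_mono kloosterman_bound that) auto
    also have "\<dots> = (6 * M ^ 8) * real p ^ 3" by simp
    also have "\<dots> \<le> (\<tau> ^ 4 * real p) * real p ^ 3"
      by (intro mult_right_mono p) auto
    also have "\<dots> = (\<tau> * real p) ^ 4"
      by (simp add: power_mult_distrib power4_eq_xxxx power3_eq_cube)
    finally have "(norm (kloosterman a b) * M\<^sup>2) ^ 4 \<le> (\<tau> * real p) ^ 4"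
      by (simp add: power_mult_distrib power_mult[symmetric])
    then have "norm (kloosterman a b) * M\<^sup>2 \<le> \<tau> * real p"
      by (rule iffD1[OF power_mono_iff, rotated 3]) (use \<tau> in auto)
    then show ?thesis using M1 by (simp add: pos_le_divide_eq)
  qed
  have corr: "(\<Sum>x\<in>U. F x * G (l * recip x)) \<le> (1 + 5 * \<tau>)\<^sup>2 / 8 * real p + \<tau> * real p"
  proof -
    have "(\<Sum>x\<in>U. F x * G (l * recip x)) \<le> (\<Sum>x\<in>Z. F x) * (\<Sum>x\<in>Z. G x) / real p + M * M * (\<tau> * real p / M\<^sup>2)"
      by (rule wiener_correlation[OF wF FG(1) wG FG(2) l K])
    also have "M * M * (\<tau> * real p / M\<^sup>2) = \<tau> * real p"
      using M1 by (simp add: power2_eq_square)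
    finally show ?thesis using prod_le by linarith
  qed

  define D where "D = {x \<in> A. f x < \<tau>}"
  define D' where "D' = {x \<in> A1. g (l * recip x) < \<tau>}"
  define E where "E = {x \<in> A1. \<tau> \<le> f x \<and> \<tau> \<le> g (l * recip x)}"
  have finA: "finite A" using finite_sub[OF A] .
  have D: "real (card D) \<le> \<tau> * real p"
    unfolding D_def f_def using \<tau> by (intro card_sparse_le A Q) auto
  have D': "real (card D') \<le> \<tau> * real p"
  proof -
    \<comment> \<open>Sparseness is known for \<open>B\<close>, and injectivity of
      \<open>\<beta>\<close> transports it back to \<open>A1\<close>.\<close>
    have "\<beta> ` D' \<subseteq> {b \<in> B. g b < \<tau>}"
      by (auto simp: D'_def B_def \<beta>_def g_mod)
    moreover have "finite {b \<in> B. g b < \<tau>}" using finite_sub[OF B] by simp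
    moreover have "inj_on \<beta> D'" by (rule inj_on_subset[OF inj]) (auto simp: D'_def A1_def)
    ultimately have "card D' \<le> card {b \<in> B. g b < \<tau>}"
      by (metis card_image card_mono)
    moreover have "real (card {b \<in> B. g b < \<tau>}) \<le> \<tau> * real p"
      unfolding g_def using \<tau> by (intro card_sparse_le B Q) auto
    ultimately show ?thesis by linarith
  qed
  have big: "1 - \<tau> \<le> 1 - (1 - y) ^ m" if "\<tau> \<le> y" "y \<le> 1" for y
  proof -
    have "(1 - y) ^ m \<le> (1 - \<tau>) ^ m" using that by (intro power_mono) auto
    with m show ?thesis by linarith
  qed
  have E: "real (card E) * (1 - \<tau>)\<^sup>2 \<le> (1 + 5 * \<tau>)\<^sup>2 / 8 * real p + \<tau> * real p"
  proof -
    \<comment> \<open>On \<open>E\<close> both amplified functions are at least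
      \<open>1 - \<tau>\<close>, by the choice of \<open>m\<close>, so the correlation sum bounds
      the size of \<open>E\<close>.\<close>
    have "real (card E) * (1 - \<tau>)\<^sup>2 = (\<Sum>x\<in>E. (1 - \<tau>) * (1 - \<tau>))"
      by (simp add: power2_eq_square)
    also have "\<dots> \<le> (\<Sum>x\<in>E. F x * G (l * recip x))"
    proof (intro sum_mono mult_mono)
      fix x assume "x \<in> E"
      then have "\<tau> \<le> f x" "\<tau> \<le> g (l * recip x)" by (simp_all add: E_def)
      then show "1 - \<tau> \<le> F x" "1 - \<tau> \<le> G (l * recip x)"
        unfolding F_def G_def using fg by (auto simp only: intro: big)
    qed (use FG \<tau> in auto)
    also have "\<dots> \<le> (\<Sum>x\<in>U. F x * G (l * recip x))"
      using FG by (intro sum_mono2) (auto simp: E_def A1_def)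
    finally show ?thesis using corr by linarith
  qed
  have "A \<subseteq> {0} \<union> D \<union> D' \<union> E"
  proof
    fix x assume x: "x \<in> A"
    then have "x = 0 \<or> x \<in> U" using A by auto
    then show "x \<in> {0} \<union> D \<union> D' \<union> E" using x by (auto simp: D_def D'_def E_def A1_def not_less)
  qed
  then have "card A \<le> card ({0} \<union> D \<union> D' \<union> E)"
    using finA by (intro card_mono) (auto simp: D_def D'_def E_def A1_def)
  also have "\<dots> \<le> card {0 :: int} + card D + card D' + card E"
    using card_Un_le[of "{0} \<union> D \<union> D'" E] card_Un_le[of "{0} \<union> D" D'] card_Un_le[of "{0}" D] by linarith
  finally have "real (card A) \<le> 1 + real (card D) + real (card D') + real (card E)"
    by simp
  moreover have "real (card E) \<le> ((1 + 5 * \<tau>)\<^sup>2 / 8 * real p + \<tau> * real p) / (1 - \<tau>)\<^sup>2"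
    using E \<tau> by (simp add: pos_le_divide_eq)
  moreover have "((1 + 5 * \<tau>)\<^sup>2 / 8 * real p + \<tau> * real p) / (1 - \<tau>)\<^sup>2 = ((1 + 5 * \<tau>)\<^sup>2 / 8 + \<tau>) / (1 - \<tau>)\<^sup>2 * real p"
    by (simp add: distrib_right)
  moreover have "1 \<le> \<tau> * real p" using p by simp
  ultimately have "real (card A) \<le> 3 * (\<tau> * real p) + ((1 + 5 * \<tau>)\<^sup>2 / 8 + \<tau>) / (1 - \<tau>)\<^sup>2 * real p"
    using D D' by linarith
  then show ?thesis by (simp add: distrib_right)
qed

end

section \<open>Choice of the parameters and translation to the residue ring\<close>

theorem theorem1:
  fixes \<alpha> :: real
  assumes "\<alpha> > 1 / 8"
  shows "\<exists>p0 :: nat. \<forall>p :: nat. prime p \<and> p \<ge> p0 \<longrightarrow>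
    (let F = residue_ring (int p) in
      \<forall>A \<subseteq> carrier F. real (card A) \<ge> \<alpha> * real p \<longrightarrow>
        carrier F - {\<zero>\<^bsub>F\<^esub>} \<subseteq>
          {x \<otimes>\<^bsub>F\<^esub> (y \<oplus>\<^bsub>F\<^esub> z) | x y z. x \<in> A \<and> y \<in> A \<and> z \<in> A})"
proof -
  \<comment> \<open>The density bound tends to 1/8 as \<open>\<tau>\<close> decreases to 0, so it
    drops below \<open>\<alpha>\<close> for some admissible \<open>\<tau>\<close>. This is where the
    strict inequality in the hypothesis is used.\<close>
  have "((\<lambda>\<tau>. 3 * \<tau> + ((1 + 5 * \<tau>)\<^sup>2 / 8 + \<tau>) / (1 - \<tau>)\<^sup>2) \<longlongrightarrow> 1 / 8) (at_right (0 :: real))"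
    by (auto intro!: tendsto_eq_intros)
  then have "\<forall>\<^sub>F \<tau> in at_right (0 :: real). 3 * \<tau> + ((1 + 5 * \<tau>)\<^sup>2 / 8 + \<tau>) / (1 - \<tau>)\<^sup>2 < \<alpha>"
    using assms by (rule order_tendstoD)
  moreover have "\<forall>\<^sub>F \<tau> in at_right (0 :: real). \<tau> \<in> {0<..<1 / 20}"
    by (rule eventually_at_right_real) simp
  ultimately have "\<forall>\<^sub>F \<tau> in at_right (0 :: real).
      3 * \<tau> + ((1 + 5 * \<tau>)\<^sup>2 / 8 + \<tau>) / (1 - \<tau>)\<^sup>2 < \<alpha> \<and> \<tau> \<in> {0<..<1 / 20}"
    by (rule eventually_conj)
  then obtain \<tau> :: real where \<tau>: "3 * \<tau> + ((1 + 5 * \<tau>)\<^sup>2 / 8 + \<tau>) / (1 - \<tau>)\<^sup>2 < \<alpha>" "0 < \<tau>" "\<tau> \<le> 1 / 20"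
    using eventually_happens'[OF trivial_limit_at_right_real] by fastforce
  obtain m where m: "(1 - \<tau>) ^ m < \<tau>"
    using real_arch_pow_inv[of \<tau> "1 - \<tau>"] \<tau> by auto
  have m0: "0 < m"
    using m \<tau> by (cases m) auto
  define \<kappa> where "\<kappa> = (\<tau> / real m) ^ 3 * (\<tau>\<^sup>2 / 4)"
  have \<kappa>: "0 < \<kappa>" using \<tau> m0 by (simp add: \<kappa>_def)
  obtain N where N: "6 * pi / \<kappa> < real N"
    using reals_Archimedean2 by blast
  moreover have "0 < 6 * pi / \<kappa>" using \<kappa> by simp
  ultimately have N0: "0 < N" by (metis of_nat_0_less_iff order.strict_trans)
  have N': "6 * pi / real N \<le> \<kappa>" using N N0 \<kappa> by (simp add: field_simps)
  obtain k where k: "4 / \<kappa>\<^sup>2 \<le> real k"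
    using real_arch_simple by blast
  define M where "M = 1 + (1 + real N ^ k) ^ m"
  \<comment> \<open>Every constant so far depends only on \<open>\<tau>\<close>; \<open>p1\<close>
    and \<open>p2\<close> encode the two largeness conditions on \<open>p\<close>.\<close>
  obtain p1 where p1: "2 / \<tau> \<le> real p1"
    using real_arch_simple by blast
  obtain p2 where p2: "6 * M ^ 8 / \<tau> ^ 4 \<le> real p2"
    using real_arch_simple by blast
  show ?thesis
  proof (intro exI[of _ "max p1 p2"] allI impI)
    fix p :: nat
    assume p: "prime p \<and> max p1 p2 \<le> p"
    then interpret prime_modulus p by unfold_locales simp
    have large: "2 \<le> \<tau> * real p" "6 * M ^ 8 \<le> \<tau> ^ 4 * real p"
    proof -
      have "2 / \<tau> \<le> real p" "6 * M ^ 8 / \<tau> ^ 4 \<le> real p"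
        using p p1 p2 by (auto intro: order.trans)
      then show "2 \<le> \<tau> * real p" "6 * M ^ 8 \<le> \<tau> ^ 4 * real p"
        using \<tau> by (simp_all add: pos_divide_le_eq mult.commute)
    qed
    have R: "carrier (residue_ring (int p)) = Z" "\<zero>\<^bsub>residue_ring (int p)\<^esub> = 0"
        "x \<oplus>\<^bsub>residue_ring (int p)\<^esub> y = (x + y) mod int p" "x \<otimes>\<^bsub>residue_ring (int p)\<^esub> y = x * y mod int p" for x y
      by (auto simp: residue_ring_def)
    have main: "l \<in> {x * ((y + z) mod int p) mod int p |x y z. x \<in> A \<and> y \<in> A \<and> z \<in> A}"
      if A: "A \<subseteq> Z" "\<alpha> * real p \<le> real (card A)" and l: "l \<in> Z" "l \<noteq> 0" for A l
    proof (rule ccontr)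
      assume no: "\<not> ?thesis"
      have "\<not> int p dvd x * (y + z) - l" if "x \<in> A" "y \<in> A" "z \<in> A" for x y z
      proof
        assume "int p dvd x * (y + z) - l"
        then have "x * (y + z) mod int p = l mod int p"
          by (simp add: mod_eq_dvd_iff)
        with l have "l = x * ((y + z) mod int p) mod int p"
          by (simp add: mod_simps)
        with no that show False by blast
      qed
      then have "real (card A) \<le> (3 * \<tau> + ((1 + 5 * \<tau>)\<^sup>2 / 8 + \<tau>) / (1 - \<tau>)\<^sup>2) * real p"
        using card_le_of_not_represented[OF \<tau>(2,3) m0 less_imp_le[OF m] \<kappa>_def N0 N' k M_def large A(1)]
          Z_not_dvd[OF l] by blast
      also have "\<dots> < \<alpha> * real p"
        using \<tau>(1) by (intro mult_strict_right_mono) auto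
      finally show False using A(2) by linarith
    qed
    show "let F = residue_ring (int p) in
      \<forall>A \<subseteq> carrier F. real (card A) \<ge> \<alpha> * real p \<longrightarrow>
        carrier F - {\<zero>\<^bsub>F\<^esub>} \<subseteq>
          {x \<otimes>\<^bsub>F\<^esub> (y \<oplus>\<^bsub>F\<^esub> z) | x y z. x \<in> A \<and> y \<in> A \<and> z \<in> A}"
      unfolding Let_def R
    proof (intro allI impI subsetI)
      fix A l assume "A \<subseteq> Z" "\<alpha> * real p \<le> real (card A)" "l \<in> Z - {0}"
      then show "l \<in> {x * ((y + z) mod int p) mod int p |x y z. x \<in> A \<and> y \<in> A \<and> z \<in> A}"
        by (intro main) simp_all
    qed
  qed
qed

end
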